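(* Let $q<p<q+1$. Suppose that $t^p\dot\delta(t)+pt^{p-1}\delta(t)-a\beta\ge 0$ for all $t\ge t_0$, and that there exists $K_1>0$ such that $t\,\dot\delta(t)<K_1\,\delta(t)$ for all $t$ big enough. Let $x:[t_0,+\infty)\to\mathcal X$ be the unique global solution of the system (DS) given in the context, and let $x_t$ and $\bar x^*$ be as defined in the context. Then: (i) $x(t)$ converges strongly to $\bar x^*=\mathrm{proj}_{\operatorname{argmin} g}0$, that is, $\lim_{t\to+\infty}\|x(t)-\bar x^*\|=0$. (ii) If $q<p<\frac12(3q+1)$, then as $t\to+\infty$, $$\|\dot x(t)+\beta\nabla g(x(t))\|=\mathcal O\left(\frac{1}{t^{\frac{p+1-\max\{q,p-q\}}{2}}}\right),\quad \|x(t)-x_t\|=\mathcal O\left(\frac{1}{t^{\frac{1-q}{2}}}\right),\quad g(x(t))-g(\bar x^* )=\mathcal O\left(\frac{1}{\delta(t)t^p}\right).$$ (iii) If $\frac12(3q+1)\le p<q+1$, then as $t\to+\infty$, $$\|\dot x(t)+\beta\nabla g(x(t))\|=\mathcal O\left(\frac{1}{t^{2q-p+1}}\right)\quad\text{and}\quad \|x(t)-x_t\|=\mathcal O\left(\frac{1}{t^{q-p+1}}\right).$$ Further, if $\frac12(3q+1)\le p\le\frac13(4q+2)$, then $g(x(t))-g(\bar x^* )=\mathcal O\left(\frac{1}{\delta(t)t^p}\right)$ as $t\to+\infty$, and if $\frac13(4q+2)<p<q+1$, then $g(x(t))-g(\bar x^* )=\mathcal O\left(\frac{1}{\delta(t)t^{4q-2p+2}}\right)$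 as $t\to+\infty$.
   Context: $\mathcal X$ is a real Hilbert space with inner product $\langle\cdot,\cdot\rangle$ and norm $\|\cdot\|$. $g:\mathcal X\to\mathbb R$ is a convex, twice differentiable function whose set of minimizers $\operatorname{argmin} g$ is nonempty. The parameters satisfy $t_0>0$, $\alpha,\beta,a,p>0$, $0<q<1$. The time scaling function $\delta:[t_0,+\infty)\to(0,+\infty)$ is differentiable and non-decreasing with $\lim_{t\to+\infty}\delta(t)=+\infty$. The system (DS) is $$\ddot x(t)+\frac{\alpha}{t^q}\dot x(t)+\beta\nabla^2 g(x(t))\dot x(t)+\delta(t)\nabla g(x(t))+\frac{a}{t^p}x(t)=0,\qquad t\ge t_0.$$ A (strong) global solution is a function $x:[t_0,+\infty)\to\mathcal X$ with $x$ and $\dot x$ locally absolutely continuous, satisfying the equation for almost every $t\ge t_0$, with prescribed initial data $(x(t_0),\dot x(t_0))\in\mathcal X\times\mathcal X$. For $t\ge t_0$, $x_t$ denotes the unique minimizer over $\mathcal X$ of the strongly convex function $g_t(x):=g(x)+\frac{a}{2\delta(t)t^p}\|x\|^2$. The point $\bar x^*:=\mathrm{proj}_{\operatorname{argmin} g}0$ is the minimal norm element of $\operatorname{argmin} g$ ($\mathrm{proj}$ is the metric projection). *)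

theory Defs
  imports "HOL-Analysis.Analysis" "HOL-Library.Landau_Symbols"
begin

text \<open>
  Absolute continuity in the usual epsilon-delta form.  A finite family of non-overlapping compact
  subintervals is a division of its union; the endpoints of \<open>k\<close> are \<open>Inf k\<close> and \<open>Sup k\<close>.
\<close>

definition abs_continuous_on_interval :: "real \<Rightarrow> real \<Rightarrow> (real \<Rightarrow> 'a::real_normed_vector) \<Rightarrow> bool"
  where "abs_continuous_on_interval r s f \<longleftrightarrow>
    (\<forall>\<epsilon>>0. \<exists>\<eta>>0. \<forall>D. D division_of \<Union>D \<longrightarrow> \<Union>D \<subseteq> {r..s} \<longrightarrow>
        (\<Sum>k\<in>D. Sup k - Inf k) < \<eta> \<longrightarrow>
        (\<Sum>k\<in>D. norm (f (Sup k) - f (Inf k))) < \<epsilon>)"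

definition locally_abs_continuous_from :: "real \<Rightarrow> (real \<Rightarrow> 'a::real_normed_vector) \<Rightarrow> bool"
  where "locally_abs_continuous_from t0 f \<longleftrightarrow>
    (\<forall>r s. t0 \<le> r \<longrightarrow> r \<le> s \<longrightarrow> abs_continuous_on_interval r s f)"

definition argmin :: "('a \<Rightarrow> real) \<Rightarrow> 'a set"
  where "argmin g = {y. is_arg_min g (\<lambda>_. True) y}"

text \<open>
  The metric projection.  The library's \<open>closest_point\<close> is restricted to Heine-Borel spaces,
  which excludes infinite-dimensional Hilbert spaces.
\<close>

definition metric_proj :: "'a::metric_space set \<Rightarrow> 'a \<Rightarrow> 'a"
  where "metric_proj S z = arg_min_on (dist z) S"

text \<open>The minimizer \<open>x\<^sub>t\<close> of the Tikhonov regularization of \<open>g\<close> at time \<open>t\<close>.\<close>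

definition tikhonov_min ::
    "('a::real_inner \<Rightarrow> real) \<Rightarrow> real \<Rightarrow> real \<Rightarrow> (real \<Rightarrow> real) \<Rightarrow> real \<Rightarrow> 'a"
  where "tikhonov_min g a p \<delta> t =
    arg_min (\<lambda>y. g y + a / (2 * \<delta> t * t powr p) * (norm y)\<^sup>2) (\<lambda>_. True)"

text \<open>
  Strong global solutions with initial data \<open>(u0, v0)\<close>.  The arguments \<open>grad\<close> and \<open>hess\<close> are the
  gradient and the Hessian of the potential, \<open>v\<close> is the derivative of the trajectory \<open>x\<close>
  (one-sided at \<open>t0\<close>) and \<open>w\<close> is its second derivative, which need exist only almost everywhere.
\<close>

definition strong_global_solution ::
    "real \<Rightarrow> real \<Rightarrow> real \<Rightarrow> real \<Rightarrow> real \<Rightarrow> real \<Rightarrow> (real \<Rightarrow> real) \<Rightarrow>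
     ('a::real_inner \<Rightarrow> 'a) \<Rightarrow> ('a \<Rightarrow> 'a \<Rightarrow> 'a) \<Rightarrow> 'a \<Rightarrow> 'a \<Rightarrow> (real \<Rightarrow> 'a) \<Rightarrow> (real \<Rightarrow> 'a) \<Rightarrow> bool"
  where "strong_global_solution t0 \<alpha> \<beta> a p q \<delta> grad hess u0 v0 x v \<longleftrightarrow>
    (\<forall>t\<ge>t0. (x has_vector_derivative v t) (at t within {t0..})) \<and>
    locally_abs_continuous_from t0 x \<and>
    locally_abs_continuous_from t0 v \<and>
    (AE t in lebesgue. t \<ge> t0 \<longrightarrow>
       (\<exists>w. (v has_vector_derivative w) (at t within {t0..}) \<and>
            w + (\<alpha> / t powr q) *\<^sub>R v t + \<beta> *\<^sub>R hess (x t) (v t)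
              + \<delta> t *\<^sub>R grad (x t) + (a / t powr p) *\<^sub>R x t = 0)) \<and>
    x t0 = u0 \<and> v t0 = v0"

end

theory Submission
  imports Defs
begin

text \<open>
  With \<open>y = v + \<beta> grad x\<close> the Hessian disappears from the system, which becomes first order in
  \<open>(x, y)\<close>. Put \<open>\<epsilon> = a / (\<delta> t\<^sup>p)\<close>, let \<open>\<xi>\<close> be the minimizer of \<open>g + \<epsilon>/2 |\<cdot>|\<^sup>2\<close>, \<open>\<phi>\<close> the
  regularized value gap of \<open>x\<close> over \<open>\<xi>\<close>, \<open>b = \<alpha>/2 t\<^sup>-\<^sup>q\<close> and \<open>w = b (x - \<xi>)\<close>. The weights in
  \<open>E = \<delta> \<phi> + 1/2 |w + y|\<^sup>2 + 1/2 |w|\<^sup>2\<close> are chosen so that all indefinite terms of \<open>E'\<close> cancel.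
  The growth hypothesis on \<open>\<delta>\<close> says exactly \<open>\<epsilon>' \<le> - \<beta> \<epsilon>\<^sup>2\<close>; it absorbs the Tikhonov contribution of
  Hessian damping, and it gives \<open>\<epsilon> = O(1/t)\<close>. Since \<open>\<xi>\<close> moves at speed \<open>O(1/t)\<close>, with
  \<open>m = max q (p - q) < 1\<close> one gets \<open>E' \<le> - c t\<^sup>-\<^sup>m E + C (t\<^sup>-\<^sup>p\<^sup>-\<^sup>1 + t\<^sup>m\<^sup>-\<^sup>2\<^sup>q\<^sup>-\<^sup>2)\<close>, so \<open>E = O(t\<^sup>-\<^sup>s)\<close> with
  \<open>s = min (p + 1 - m) (2 q + 2 - 2 m)\<close>. All rates are read off from \<open>E\<close>, and \<open>\<xi>\<close> converges to the
  minimizer of least norm.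
\<close>

section \<open>Regularity of the momentum\<close>

text \<open>Tags outside \<open>N\<close> are controlled by the derivative. Tags in \<open>N\<close>
  are forced by the gauge into an open set of small measure, where absolute continuity makes the
  total increment small. The gauge integral is used so that the result can later be added to the
  integral of a derivative that may fail to be Lebesgue integrable.\<close>

lemma abs_continuous_has_integral:
  fixes f w :: "real \<Rightarrow> 'a::real_normed_vector"
  assumes ac: "abs_continuous_on_interval r s f" and "r \<le> s" and N: "negligible N"
    and der: "\<And>t. t \<in> {r..s} - N \<Longrightarrow> (f has_vector_derivative w t) (at t within {r..s})"
  shows "(w has_integral (f s - f r)) {r..s}"
proof -
  \<comment> \<open>With the value 0 on \<open>N\<close>, a tag there contributes only an increment
    of \<open>f\<close> to the error; the spike at the end restores \<open>w\<close>.\<close>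
  define w' where "w' = (\<lambda>t. if t \<in> N then 0 else w t)"
  have "(w' has_integral (f s - f r)) {r..s}"
    unfolding has_integral_real
  proof (intro allI impI)
    fix e :: real assume "e > 0"
    then obtain \<eta> where \<eta>: "\<eta> > 0" "\<And>D. D division_of \<Union>D \<Longrightarrow> \<Union>D \<subseteq> {r..s} \<Longrightarrow>
        (\<Sum>k\<in>D. Sup k - Inf k) < \<eta> \<Longrightarrow> (\<Sum>k\<in>D. norm (f (Sup k) - f (Inf k))) < e / 2"
      using ac unfolding abs_continuous_on_interval_def by (meson half_gt_zero)
    have Nnull: "N \<in> null_sets lebesgue" using N negligible_iff_null_sets by blast
    then obtain T where T: "open T" "N \<subseteq> T" "T - N \<in> lmeasurable"
        "emeasure lebesgue (T - N) < ennreal \<eta>"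
      using sets_lebesgue_outer_open[of N \<eta>] \<eta>(1) by blast
    have Tm: "T \<in> lmeasurable" "measure lebesgue T < \<eta>"
    proof -
      have "T = (T - N) \<union> N" using T by auto
      then have eq: "emeasure lebesgue T = emeasure lebesgue (T - N)"
        using emeasure_Un_null_set[of "T - N" lebesgue N] Nnull T(3) by (auto simp: fmeasurable_def)
      with T(4) have lt: "emeasure lebesgue T < ennreal \<eta>" by simp
      show Tm: "T \<in> lmeasurable"
        by (rule fmeasurableI) (use T(1) lt in \<open>auto intro: less_trans[OF _ ennreal_less_top]\<close>)
      show "measure lebesgue T < \<eta>"
        using lt unfolding emeasure_eq_measure2[OF Tm] by (simp add: ennreal_less_iff)
    qed
    \<comment> \<open>This slope tolerance spends the other half of \<open>e\<close> over the whole
      interval; the \<open>+ 1\<close> keeps the denominator positive when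
      \<open>r = s\<close>.\<close>
    define e' where "e' = e / (2 * (s - r + 1))"
    have e': "e' > 0" using \<open>e > 0\<close> \<open>r \<le> s\<close> by (simp add: e'_def)
    have "\<exists>d>0. \<forall>y\<in>{r..s}. \<bar>y - t\<bar> < d \<longrightarrow> norm (f y - f t - (y - t) *\<^sub>R w t) \<le> e' * \<bar>y - t\<bar>"
      if "t \<in> {r..s} - N" for t
      using der[OF that] e' unfolding has_vector_derivative_def has_derivative_within_alt
      by (metis real_norm_def)
    then obtain d where d: "\<And>t. t \<in> {r..s} - N \<Longrightarrow> d t > 0"
      "\<And>t y. t \<in> {r..s} - N \<Longrightarrow> y \<in> {r..s} \<Longrightarrow> \<bar>y - t\<bar> < d t \<Longrightarrow>
         norm (f y - f t - (y - t) *\<^sub>R w t) \<le> e' * \<bar>y - t\<bar>" by metis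
    define \<gamma> where "\<gamma> = (\<lambda>t. if t \<in> N then T else if t \<in> {r..s} then ball t (d t) else UNIV)"
    have gauge: "gauge \<gamma>"
      using T d(1) unfolding gauge_def \<gamma>_def by auto
    have approx: "norm ((\<Sum>(x, k)\<in>\<D>. measure lborel k *\<^sub>R w' x) - (f s - f r)) < e"
      if tag: "\<D> tagged_division_of {r..s}" and fine: "\<gamma> fine \<D>" for \<D>
    proof -
      have fin: "finite \<D>" using tag by blast
      have interval: "\<exists>u v. k = {u..v} \<and> u \<le> x \<and> x \<le> v \<and> {u..v} \<subseteq> {r..s}" if "(x, k) \<in> \<D>" for x k
        using tagged_division_ofD(2,3,4)[OF tag that] by (auto simp: box_real) 
      define A where "A = {xk \<in> \<D>. fst xk \<in> N}"
      define err where "err = (\<lambda>(x, k). f (Sup k) - f (Inf k) - measure lborel k *\<^sub>R w' x)"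
      have part: "A tagged_partial_division_of {r..s}"
        using tag unfolding A_def tagged_division_of_def
        by (auto intro: tagged_partial_division_subset)
      have divA: "(snd ` A) division_of \<Union>(snd ` A)"
        by (rule partial_division_of_tagged_division[OF part])
      have subT: "\<Union>(snd ` A) \<subseteq> T"
        using fine unfolding fine_def A_def \<gamma>_def by fastforce
      have subI: "\<Union>(snd ` A) \<subseteq> {r..s}"
        using interval unfolding A_def by fastforce
      have len: "Sup k - Inf k = measure lborel k" if k: "(x, k) \<in> \<D>" for x k
        using interval[OF k] by auto
      have "(\<Sum>k\<in>snd ` A. Sup k - Inf k) = (\<Sum>k\<in>snd ` A. measure lebesgue k)"
        by (rule sum.cong) (use len interval in \<open>fastforce simp: A_def measure_completion\<close>)+
      also have "\<dots> = measure lebesgue (\<Union>(snd ` A))"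
        by (rule content_division[OF divA])
      also have "\<dots> \<le> measure lebesgue T"
        by (rule measure_mono_fmeasurable[OF subT _ Tm(1)]) (use lmeasurable_division[OF divA] in auto)
      finally have small: "(\<Sum>k\<in>snd ` A. norm (f (Sup k) - f (Inf k))) < e / 2"
        using \<eta>(2)[OF divA subI] Tm(2) by linarith
      \<comment> \<open>Passage from intervals to tagged intervals: one interval can carry two tags
        only if its interior is empty, and then the increment over it vanishes.\<close>
      have "(\<Sum>k\<in>snd ` A. norm (f (Sup k) - f (Inf k)))
          = (\<Sum>xk\<in>A. norm (f (Sup (snd xk)) - f (Inf (snd xk))))"
      proof (subst sum.reindex_nontrivial)
        show "finite A" using fin by (simp add: A_def)
        fix xk xk' assume *: "xk \<in> A" "xk' \<in> A" "xk \<noteq> xk'" "snd xk = snd xk'"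
        obtain x k where xk: "xk = (x, k)" by force
        obtain x' where xk': "xk' = (x', k)" using * xk by (cases xk') auto
        have "interior k \<inter> interior k = {}"
          using tagged_partial_division_ofD(5)[OF part, of x k x' k] * xk xk' by auto
        moreover obtain u v where "k = {u..v}" "u \<le> x" "x \<le> v"
          using interval[of x k] *(1) xk by (auto simp: A_def)
        ultimately have "u = v" by (auto simp: interior_atLeastAtMost_real)
        then show "norm (f (Sup (snd xk)) - f (Inf (snd xk))) = 0"
          using xk \<open>k = {u..v}\<close> by simp
      qed auto
      also have "\<dots> = (\<Sum>xk\<in>A. norm (err xk))"
        by (rule sum.cong) (auto simp: err_def A_def w'_def split_beta)
      finally have errA: "(\<Sum>xk\<in>A. norm (err xk)) < e / 2" using small by simp
      have pt: "norm (err xk) \<le> e' * measure lborel (snd xk)" if m: "xk \<in> \<D> - A" for xk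
      proof -
        obtain x k where xk: "xk = (x, k)" by force
        then have k: "(x, k) \<in> \<D>" and xN: "x \<notin> N" using m by (auto simp: A_def)
        obtain u v where uv: "k = {u..v}" "u \<le> x" "x \<le> v" "{u..v} \<subseteq> {r..s}"
          using interval[OF k] by blast
        have xI: "x \<in> {r..s} - N" and uI: "u \<in> {r..s}" and vI: "v \<in> {r..s}" using uv xN by auto
        have "k \<subseteq> ball x (d x)" using fineD[OF fine k] xI by (simp add: \<gamma>_def)
        moreover have "u \<in> k" "v \<in> k" using uv by auto
        ultimately have "u \<in> ball x (d x)" "v \<in> ball x (d x)" by blast+
        then have b: "\<bar>u - x\<bar> < d x" "\<bar>v - x\<bar> < d x"
          by (auto simp: dist_real_def abs_minus_commute)
        \<comment> \<open>The error is split at the tag \<open>x\<close>; since \<open>x\<close>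
          lies between \<open>u\<close> and \<open>v\<close>, the two bounds add up to
          \<open>e'\<close> times the length.\<close>
        have "err xk = (f v - f x - (v - x) *\<^sub>R w x) - (f u - f x - (u - x) *\<^sub>R w x)"
          using uv xN by (simp add: err_def xk w'_def algebra_simps)
        also have "norm \<dots> \<le> e' * \<bar>v - x\<bar> + e' * \<bar>u - x\<bar>"
          using d(2)[OF xI uI b(1)] d(2)[OF xI vI b(2)] norm_triangle_ineq4 by (smt (verit))
        also have "\<dots> = e' * measure lborel (snd xk)" using uv xk by (simp add: algebra_simps)
        finally show ?thesis .
      qed
      have "(\<Sum>xk\<in>\<D> - A. norm (err xk)) \<le> (\<Sum>xk\<in>\<D> - A. e' * measure lborel (snd xk))"
        by (rule sum_mono) (rule pt)
      also have "\<dots> \<le> (\<Sum>xk\<in>\<D>. e' * measure lborel (snd xk))"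
        by (rule sum_mono2) (use fin e' in auto)
      also have "\<dots> = e' * (s - r)"
        using additive_content_tagged_division[of \<D> r s] tag \<open>r \<le> s\<close>
        by (simp add: sum_distrib_left[symmetric] split_beta)
      also have "\<dots> \<le> e / 2"
      proof -
        have "e' * (s - r) \<le> e' * (s - r + 1)" using e' by simp
        also have "\<dots> = e / 2" using \<open>r \<le> s\<close> by (simp add: e'_def field_simps)
        finally show ?thesis .
      qed
      finally have errB: "(\<Sum>xk\<in>\<D> - A. norm (err xk)) \<le> e / 2" .
      have "(\<Sum>(x, k)\<in>\<D>. measure lborel k *\<^sub>R w' x) - (f s - f r) = - (\<Sum>xk\<in>\<D>. err xk)"
        unfolding additive_tagged_division_1[OF \<open>r \<le> s\<close> tag, of f, symmetric] err_def
        by (simp add: split_beta sum_subtractf)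
      also have "norm \<dots> \<le> (\<Sum>xk\<in>\<D>. norm (err xk))"
        by (simp add: norm_sum)
      also have "\<dots> = (\<Sum>xk\<in>\<D> - A. norm (err xk)) + (\<Sum>xk\<in>A. norm (err xk))"
        by (rule sum.subset_diff) (use fin in \<open>auto simp: A_def\<close>)
      finally show ?thesis using errA errB by linarith
    qed
    show "\<exists>\<gamma>. gauge \<gamma> \<and> (\<forall>\<D>. \<D> tagged_division_of {r..s} \<and> \<gamma> fine \<D> \<longrightarrow>
        norm ((\<Sum>(x, k)\<in>\<D>. measure lborel k *\<^sub>R w' x) - (f s - f r)) < e)"
      by (intro exI[of _ \<gamma>] conjI allI impI gauge approx) simp_all
  qed
  then show ?thesis
    by (rule has_integral_spike[OF N, rotated]) (auto simp: w'_def)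
qed

text \<open>Testing with the remainder \<open>k\<close> itself turns its squared norm into the
  integral of \<open>inner (c \<tau> - c t) k\<close>, which continuity of \<open>c\<close> bounds
  by \<open>\<eta> * (s - r) * norm k\<close>. Testing against vectors keeps every integral
  scalar.\<close>

lemma has_vector_derivative_of_weak_integral:
  fixes y c :: "real \<Rightarrow> 'a::real_inner"
  assumes cont: "continuous_on {t0..} c"
    and ftc: "\<And>e r s. t0 \<le> r \<Longrightarrow> r \<le> s \<Longrightarrow>
      ((\<lambda>t. inner (c t) e) has_integral inner (y s - y r) e) {r..s}"
    and t: "t0 < t"
  shows "(y has_vector_derivative c t) (at t)"
  unfolding has_vector_derivative_def has_derivative_at_alt
proof (intro conjI allI impI)
  show "bounded_linear (\<lambda>h. h *\<^sub>R c t)" by (rule bounded_linear_scaleR_left)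
next
  fix \<eta> :: real assume \<eta>: "\<eta> > 0"
  obtain d0 where d0: "d0 > 0" "\<And>s. s \<ge> t0 \<Longrightarrow> \<bar>s - t\<bar> < d0 \<Longrightarrow> norm (c s - c t) < \<eta>"
    using cont \<eta> t unfolding continuous_on_iff
    by (metis atLeast_iff dist_norm less_imp_le real_norm_def)
  define d where "d = min d0 (t - t0)"
  have est: "norm (y s - y r - (s - r) *\<^sub>R c t) \<le> \<eta> * (s - r)"
    if rs: "r \<le> s" "\<bar>r - t\<bar> < d" "\<bar>s - t\<bar> < d" for r s
  proof -
    define k where "k = y s - y r - (s - r) *\<^sub>R c t"
    have "t0 \<le> r" using rs by (auto simp: d_def)
    have "((\<lambda>\<tau>. inner (c \<tau>) k - inner (c t) k) has_integral
        inner (y s - y r) k - inner (c t) k * (s - r)) {r..s}"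
      using has_integral_diff[OF ftc[OF \<open>t0 \<le> r\<close> rs(1), of k]
        has_integral_const_real[of "inner (c t) k" r s]] rs(1) by (simp add: mult.commute)
    also have "inner (y s - y r) k - inner (c t) k * (s - r) = inner k k"
      by (simp add: k_def inner_diff_left inner_diff_right algebra_simps)
    finally have "norm (inner k k) \<le> \<eta> * norm k * measure lborel {r..s}"
    proof (rule has_integral_bound_real[rotated 2])
      fix \<tau> assume \<tau>: "\<tau> \<in> {r..s} - {}"
      have "norm (inner (c \<tau>) k - inner (c t) k) = \<bar>inner (c \<tau> - c t) k\<bar>"
        by (simp add: inner_diff_left)
      also have "\<dots> \<le> norm (c \<tau> - c t) * norm k" by (rule Cauchy_Schwarz_ineq2)
      also have "\<dots> \<le> \<eta> * norm k"
      proof (rule mult_right_mono)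
        have "d \<le> d0" by (simp add: d_def)
        then have "\<bar>\<tau> - t\<bar> < d0" using \<tau> rs by (auto simp: abs_real_def split: if_splits)
        then show "norm (c \<tau> - c t) \<le> \<eta>" using d0(2)[of \<tau>] \<tau> \<open>t0 \<le> r\<close> by auto
      qed simp
      finally show "norm (inner (c \<tau>) k - inner (c t) k) \<le> \<eta> * norm k" .
    qed (use \<eta> in auto)
    then have "norm k * norm k \<le> (\<eta> * (s - r)) * norm k"
      using rs(1) by (simp add: power2_norm_eq_inner[symmetric] power2_eq_square algebra_simps)
    then show ?thesis
      unfolding k_def[symmetric] using \<eta> rs(1)
      by (cases "k = 0") (auto dest: mult_right_le_imp_le)
  qed
  show "\<exists>d>0. \<forall>s. norm (s - t) < d \<longrightarrow>
      norm (y s - y t - (s - t) *\<^sub>R c t) \<le> \<eta> * norm (s - t)"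
  proof (intro exI[of _ d] conjI allI impI)
    show dpos: "d > 0" using d0 t by (simp add: d_def)
    fix s assume s: "norm (s - t) < d"
    show "norm (y s - y t - (s - t) *\<^sub>R c t) \<le> \<eta> * norm (s - t)"
    proof (cases "t \<le> s")
      case True
      then show ?thesis using est[of t s] s dpos by simp
    next
      case False
      have "y s - y t - (s - t) *\<^sub>R c t = - (y t - y s - (t - s) *\<^sub>R c t)"
        by (simp add: algebra_simps)
      then show ?thesis using est[of s t] s dpos False by (metis abs_minus_commute abs_of_nonneg
            diff_ge_0_iff_ge linear norm_minus_cancel real_norm_def abs_zero diff_self)
    qed
  qed
qed

text \<open>
  The Hessian is not assumed continuous, so \<open>grad (x t)\<close> is differentiable everywhere but perhaps not
  absolutely continuous, and \<open>hess (x t) (v t)\<close> perhaps not Lebesgue integrable. The equation is therefore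
  integrated in the sense of Henstock and Kurzweil; this makes \<open>v + \<beta> grad x\<close> continuously
  differentiable although \<open>v\<close> alone need not be.
\<close>

lemma strong_global_solution_derivs:
  fixes x v :: "real \<Rightarrow> 'a::real_inner"
  assumes grad: "\<And>y. (grad has_derivative hess y) (at y)"
    and t0: "t0 > 0"
    and \<delta>: "continuous_on {t0..} \<delta>"
    and sol: "strong_global_solution t0 \<alpha> \<beta> a p q \<delta> grad hess u0 v0 x v"
    and t: "t > t0"
  shows "(x has_vector_derivative v t) (at t)"
    and "((\<lambda>t. v t + \<beta> *\<^sub>R grad (x t)) has_vector_derivative
      - ((\<alpha> / t powr q) *\<^sub>R v t + \<delta> t *\<^sub>R grad (x t) + (a / t powr p) *\<^sub>R x t)) (at t)"
proof -
  have xd: "(x has_vector_derivative v t) (at t within {t0..})" if "t \<ge> t0" for t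
    using sol that by (simp add: strong_global_solution_def)
  have at: "at t within {t0..} = at t"
    using t by (intro at_within_interior) (simp add: interior_real_atLeast)
  show "(x has_vector_derivative v t) (at t)"
    using xd[of t] t at by simp
  define c where "c = (\<lambda>t. - ((\<alpha> / t powr q) *\<^sub>R v t + \<delta> t *\<^sub>R grad (x t) + (a / t powr p) *\<^sub>R x t))"
  define y where "y = (\<lambda>t. v t + \<beta> *\<^sub>R grad (x t))"
  define Q where "Q = (\<lambda>t w. (v has_vector_derivative w) (at t within {t0..}) \<and>
            w + (\<alpha> / t powr q) *\<^sub>R v t + \<beta> *\<^sub>R hess (x t) (v t)
              + \<delta> t *\<^sub>R grad (x t) + (a / t powr p) *\<^sub>R x t = 0)"
  have "AE t in lebesgue. t \<ge> t0 \<longrightarrow> (\<exists>w. Q t w)"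
    and acv: "locally_abs_continuous_from t0 v"
    using sol by (auto simp: strong_global_solution_def Q_def)
  then obtain N where N: "N \<in> null_sets lebesgue"
    and "{t \<in> space lebesgue. \<not> (t \<ge> t0 \<longrightarrow> (\<exists>w. Q t w))} \<subseteq> N"
    unfolding eventually_ae_filter by blast
  then have "\<exists>w. Q t w" if "t \<ge> t0" "t \<notin> N" for t using that by auto
  then obtain w where w: "\<And>t. t \<ge> t0 \<Longrightarrow> t \<notin> N \<Longrightarrow> Q t (w t)" by metis
  then have wd: "\<And>t. t \<ge> t0 \<Longrightarrow> t \<notin> N \<Longrightarrow> (v has_vector_derivative w t) (at t within {t0..})"
    and weq: "\<And>t. t \<ge> t0 \<Longrightarrow> t \<notin> N \<Longrightarrow> w t + (\<alpha> / t powr q) *\<^sub>R v t + \<beta> *\<^sub>R hess (x t) (v t)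
              + \<delta> t *\<^sub>R grad (x t) + (a / t powr p) *\<^sub>R x t = 0"
    by (auto simp: Q_def)
  have negN: "negligible N" using N by (simp add: negligible_iff_null_sets)
  have ac: "abs_continuous_on_interval r s v" if "t0 \<le> r" "r \<le> s" for r s
    using acv that by (simp add: locally_abs_continuous_from_def)
  have gradx: "((\<lambda>t. grad (x t)) has_vector_derivative hess (x t) (v t)) (at t within {t0..})"
    if "t \<ge> t0" for t
  proof -
    have "((\<lambda>t. grad (x t)) has_derivative (\<lambda>h. hess (x t) (h *\<^sub>R v t))) (at t within {t0..})"
      using has_derivative_compose[OF xd[OF that, unfolded has_vector_derivative_def] grad] .
    then show ?thesis
      unfolding has_vector_derivative_def
      using has_derivative_bounded_linear[OF grad] by (simp add: linear_cmul bounded_linear.linear)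
  qed
  have cont_gx: "continuous_on {t0..} (\<lambda>t. grad (x t))"
    by (rule continuous_on_vector_derivative[of _ _ "\<lambda>t. hess (x t) (v t)"]) (simp add: gradx)
  have cont_x: "continuous_on {t0..} x"
    by (rule continuous_on_vector_derivative[of _ _ v]) (simp add: xd)
  \<comment> \<open>Absolute continuity is applied to the division that consists of the single
    interval between \<open>r\<close> and \<open>s\<close>; the right end \<open>s + 1\<close>
    leaves room beyond \<open>s\<close>.\<close>
  have cont_v: "continuous_on {t0..} v"
    unfolding continuous_on_iff
  proof (intro ballI allI impI)
    fix s \<epsilon> :: real assume s: "s \<in> {t0..}" and \<epsilon>: "\<epsilon> > 0"
    obtain \<eta> where \<eta>: "\<eta> > 0" "\<And>D. D division_of \<Union>D \<Longrightarrow> \<Union>D \<subseteq> {t0..s + 1} \<Longrightarrow>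
        (\<Sum>k\<in>D. Sup k - Inf k) < \<eta> \<Longrightarrow> (\<Sum>k\<in>D. norm (v (Sup k) - v (Inf k))) < \<epsilon>"
      using ac[of t0 "s + 1"] s \<epsilon> unfolding abs_continuous_on_interval_def by auto
    show "\<exists>d>0. \<forall>r\<in>{t0..}. dist r s < d \<longrightarrow> dist (v r) (v s) < \<epsilon>"
    proof (intro exI[of _ "min \<eta> 1"] conjI ballI impI)
      fix r assume r: "r \<in> {t0..}" "dist r s < min \<eta> 1"
      define k where "k = {min r s..max r s}"
      have kmm: "Sup k = max r s" "Inf k = min r s" by (auto simp: k_def)
      have "{k} division_of \<Union>{k}"
        unfolding k_def using division_of_self[of "min r s" "max r s"] by auto
      moreover have "\<Union>{k} \<subseteq> {t0..s + 1}"
      proof -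
        have "r \<le> s + 1" using r unfolding dist_real_def by linarith
        then show ?thesis using r s by (simp add: k_def)
      qed
      moreover have "max r s - min r s < \<eta>"
        using r unfolding dist_real_def by linarith
      ultimately have "norm (v (max r s) - v (min r s)) < \<epsilon>"
        using \<eta>(2)[of "{k}"] kmm by simp
      then show "dist (v r) (v s) < \<epsilon>"
        by (auto simp: dist_norm max_def min_def norm_minus_commute split: if_splits)
    qed (use \<eta> in auto)
  qed
  have "(y has_vector_derivative c t) (at t)"
  proof (rule has_vector_derivative_of_weak_integral[OF _ _ t])
    show "continuous_on {t0..} c"
      unfolding c_def using t0 by (intro continuous_intros cont_v cont_x cont_gx \<delta>) auto
    fix e :: 'a and r s assume rs: "t0 \<le> r" "r \<le> s"
    have sub: "{r..s} \<subseteq> {t0..}" using rs by auto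
    have "(w has_integral (v s - v r)) {r..s}"
      using rs sub by (intro abs_continuous_has_integral[OF ac _ negN])
        (auto intro: has_vector_derivative_within_subset[OF wd])
    then have 1: "((\<lambda>t. inner (w t) e) has_integral inner (v s - v r) e) {r..s}"
      using has_integral_linear[OF _ bounded_linear_inner_left] by (force simp: o_def)
    have 2: "((\<lambda>t. inner (\<beta> *\<^sub>R hess (x t) (v t)) e) has_integral
        inner (\<beta> *\<^sub>R grad (x s)) e - inner (\<beta> *\<^sub>R grad (x r)) e) {r..s}"
    proof (rule fundamental_theorem_of_calculus[OF rs(2)])
      fix t assume "t \<in> {r..s}"
      then have "((\<lambda>t. grad (x t)) has_vector_derivative hess (x t) (v t)) (at t within {r..s})"
        using sub by (intro has_vector_derivative_within_subset[OF gradx]) auto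
      from bounded_linear.has_vector_derivative[OF bounded_linear_compose[OF bounded_linear_inner_left
            bounded_linear_scaleR_right] this]
      show "((\<lambda>t. inner (\<beta> *\<^sub>R grad (x t)) e) has_vector_derivative
          inner (\<beta> *\<^sub>R hess (x t) (v t)) e) (at t within {r..s})" .
    qed
    \<comment> \<open>The increment of \<open>v\<close> is integrated from an almost everywhere
      derivative, that of \<open>grad (x t)\<close> from an everywhere derivative. It is their sum
      that agrees with the continuous \<open>c\<close> outside \<open>N\<close>.\<close>
    have "((\<lambda>t. inner (w t) e + inner (\<beta> *\<^sub>R hess (x t) (v t)) e) has_integral
        inner (y s - y r) e) {r..s}"
      using has_integral_add[OF 1 2]
      by (simp add: y_def inner_diff_left inner_add_left algebra_simps)
    then show "((\<lambda>t. inner (c t) e) has_integral inner (y s - y r) e) {r..s}"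
    proof (rule has_integral_spike[OF negN, rotated])
      fix t assume t: "t \<in> {r..s} - N"
      then have "w t + \<beta> *\<^sub>R hess (x t) (v t) - c t = 0"
        using weq[of t] sub by (auto simp: c_def algebra_simps)
      then have "c t = w t + \<beta> *\<^sub>R hess (x t) (v t)" by simp
      then show "inner (c t) e = inner (w t) e + inner (\<beta> *\<^sub>R hess (x t) (v t)) e"
        by (simp add: inner_add_left)
    qed
  qed
  then show "((\<lambda>t. v t + \<beta> *\<^sub>R grad (x t)) has_vector_derivative
      - ((\<alpha> / t powr q) *\<^sub>R v t + \<delta> t *\<^sub>R grad (x t) + (a / t powr p) *\<^sub>R x t)) (at t)"
    unfolding c_def y_def .
qed

section \<open>Convex functions and the Tikhonov path\<close>

text \<open>The value at a midpoint cannot fall below the infimum, so the midpoint inequality makes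
  a minimizing sequence Cauchy. Completeness supplies the limit and continuity its
  minimality.\<close>

lemma strongly_midpoint_convex_attains_min:
  fixes h :: "'a::{real_inner, complete_space} \<Rightarrow> real"
  assumes cont: "continuous_on UNIV h" and bdd: "bdd_below (range h)" and k: "k > 0"
    and mid: "\<And>u v. h ((1/2) *\<^sub>R (u + v)) \<le> (h u + h v) / 2 - k * (norm (u - v))\<^sup>2"
  shows "\<exists>z. \<forall>y. h z \<le> h y"
proof -
  define I where "I = Inf (range h)"
  have I: "I \<le> h y" for y unfolding I_def by (rule cInf_lower) (use bdd in auto)
  have "\<exists>y. h y < I + 1 / real (Suc n)" for n
  proof -
    have "Inf (range h) < I + 1 / real (Suc n)" by (simp add: I_def)
    then show ?thesis using cInf_lessD[of "range h"] by auto
  qed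
  then obtain u where u: "\<And>n. h (u n) < I + 1 / real (Suc n)" by metis
  have close: "k * (norm (u m - u n))\<^sup>2 \<le> 1 / real (Suc N)" if "m \<ge> N" "n \<ge> N" for m n N
  proof -
    have "1 / real (Suc m) \<le> 1 / real (Suc N)" "1 / real (Suc n) \<le> 1 / real (Suc N)"
      using that by (auto simp: frac_le)
    then show ?thesis
      using mid[of "u m" "u n"] I[of "(1/2) *\<^sub>R (u m + u n)"] u[of m] u[of n] by argo
  qed
  have "Cauchy u"
  proof (rule metric_CauchyI)
    fix e :: real assume "e > 0"
    then have "k * e\<^sup>2 > 0" using k by simp
    then obtain N where N: "1 / real (Suc N) < k * e\<^sup>2"
      using nat_approx_posE by blast
    show "\<exists>M. \<forall>m\<ge>M. \<forall>n\<ge>M. dist (u m) (u n) < e"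
    proof (intro exI[of _ N] allI impI)
      fix m n assume "N \<le> m" "N \<le> n"
      then have "k * (norm (u m - u n))\<^sup>2 < k * e\<^sup>2" using close N by fastforce
      then show "dist (u m) (u n) < e"
        using k \<open>e > 0\<close> by (simp add: dist_norm power_less_imp_less_base)
    qed
  qed
  then obtain z where z: "u \<longlonglongrightarrow> z" using Cauchy_convergent_iff convergent_def by blast
  have "(\<lambda>n. h (u n)) \<longlonglongrightarrow> h z"
    using cont z by (simp add: continuous_on_eq_continuous_at isCont_tendsto_compose)
  moreover have "(\<lambda>n. I + 1 / real (Suc n)) \<longlonglongrightarrow> I + 0"
    by (intro tendsto_intros LIMSEQ_Suc[OF lim_1_over_n])
  ultimately have "h z \<le> I + 0"
    by (rule LIMSEQ_le) (use u less_imp_le in blast)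
  then have "h z \<le> h y" for y using I[of y] by simp
  then show ?thesis by blast
qed

text \<open>The Lax-Milgram argument: a solution is a fixed point of
  \<open>d - \<rho> *\<^sub>R (A d - r)\<close>. Expanding the square and choosing
  \<open>\<rho>\<close> optimally gives the squared contraction factor
  \<open>1 - k\<^sup>2 / M\<^sup>2\<close>.\<close>

lemma coercive_linear_surj:
  fixes A :: "'a::{real_inner, complete_space} \<Rightarrow> 'a"
  assumes A: "bounded_linear A" and k: "k > 0" and coer: "\<And>h. k * (norm h)\<^sup>2 \<le> inner (A h) h"
  shows "\<exists>d. A d = r"
proof -
  obtain K where K: "K > 0" "\<And>h. norm (A h) \<le> norm h * K"
    using bounded_linear.pos_bounded[OF A] by blast
  \<comment> \<open>The second entry makes \<open>k < M\<close>, so that the radicand in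
    \<open>c\<close> below is positive.\<close>
  define M where "M = max K (2 * k)"
  have M: "M > 0" "k < M" "\<And>h. norm (A h) \<le> M * norm h"
  proof -
    show "M > 0" "k < M" using k by (auto simp: M_def)
    fix h show "norm (A h) \<le> M * norm h"
      using K(2)[of h] mult_right_mono[of K M "norm h"] by (simp add: M_def mult.commute)
  qed
  define \<rho> where "\<rho> = k / M\<^sup>2"
  define c where "c = sqrt (1 - k\<^sup>2 / M\<^sup>2)"
  have \<rho>: "\<rho> > 0" using k M by (simp add: \<rho>_def)
  have kM: "k\<^sup>2 / M\<^sup>2 < 1" "k\<^sup>2 / M\<^sup>2 > 0" using k M by (auto simp: power_strict_mono)
  have contr: "norm (h - \<rho> *\<^sub>R A h) \<le> c * norm h" for h
  proof -
    have "(norm (h - \<rho> *\<^sub>R A h))\<^sup>2 = (norm h)\<^sup>2 - 2 * \<rho> * inner (A h) h + \<rho>\<^sup>2 * (norm (A h))\<^sup>2"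
      unfolding power2_norm_eq_inner
      by (simp add: inner_diff_left inner_diff_right inner_commute power2_eq_square[of \<rho>] algebra_simps)
    also have "\<dots> \<le> (norm h)\<^sup>2 - 2 * \<rho> * (k * (norm h)\<^sup>2) + \<rho>\<^sup>2 * (M * norm h)\<^sup>2"
      using coer[of h] M(3)[of h] \<rho>
      by (intro add_mono diff_left_mono mult_left_mono power_mono) auto
    also have "\<dots> = (1 - k\<^sup>2 / M\<^sup>2) * (norm h)\<^sup>2"
      using M by (simp add: \<rho>_def field_simps power2_eq_square)
    also have "\<dots> = (c * norm h)\<^sup>2"
      using kM by (simp add: c_def power_mult_distrib)
    finally show ?thesis
      by (rule power2_le_imp_le) (use kM in \<open>simp add: c_def\<close>)
  qed
  have "\<exists>!d. d - \<rho> *\<^sub>R (A d - r) = d"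
  proof (rule banach_fix_type[of c])
    show "0 \<le> c" "c < 1" using kM by (auto simp: c_def)
    show "\<forall>x y. dist (x - \<rho> *\<^sub>R (A x - r)) (y - \<rho> *\<^sub>R (A y - r)) \<le> c * dist x y"
    proof (intro allI)
      fix x y
      have eq: "x - \<rho> *\<^sub>R (A x - r) - (y - \<rho> *\<^sub>R (A y - r)) = (x - y) - \<rho> *\<^sub>R A (x - y)"
        by (simp add: linear_diff[OF bounded_linear.linear[OF A]] algebra_simps)
      show "dist (x - \<rho> *\<^sub>R (A x - r)) (y - \<rho> *\<^sub>R (A y - r)) \<le> c * dist x y"
        unfolding dist_norm eq by (rule contr)
    qed
  qed
  then show ?thesis using \<rho> by auto
qed

section \<open>First and second order conditions for a differentiable convex function\<close>

locale smooth_convex =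
  fixes g :: "'a::{real_inner, complete_space} \<Rightarrow> real"
    and grad :: "'a \<Rightarrow> 'a" and hess :: "'a \<Rightarrow> 'a \<Rightarrow> 'a"
  assumes convex: "convex_on UNIV g"
    and grad: "\<And>y. GDERIV g y :> grad y"
    and hess: "\<And>y. (grad has_derivative hess y) (at y)"
begin

lemma g_deriv: "(g has_derivative (\<lambda>h. inner (grad y) h)) (at y)"
  using grad[of y] by (simp add: gderiv_def inner_commute)

lemma continuous_g: "continuous_on UNIV g"
  using g_deriv by (meson continuous_at_imp_continuous_on has_derivative_continuous)

lemma isCont_grad: "isCont grad y"
  using hess has_derivative_continuous by blast

text \<open>By convexity the difference quotients along the segment from \<open>x\<close> to
  \<open>y\<close> stay below the slope of the chord; their limit from the right is the directional
  derivative.\<close>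

lemma above_tangent: "g y \<ge> g x + inner (grad x) (y - x)"
proof -
  have "((\<lambda>s. g (x + s *\<^sub>R (y - x))) has_derivative (\<lambda>s. inner (grad (x + 0 *\<^sub>R (y - x))) (s *\<^sub>R (y - x)))) (at 0)"
    by (rule has_derivative_compose[OF _ g_deriv]) (auto intro!: derivative_eq_intros)
  then have "((\<lambda>s. g (x + s *\<^sub>R (y - x))) has_real_derivative inner (grad x) (y - x)) (at 0)"
    unfolding has_field_derivative_def by (simp add: mult_commute_abs)
  then have "((\<lambda>s. (g (x + s *\<^sub>R (y - x)) - g x) / s) \<longlongrightarrow> inner (grad x) (y - x)) (at_right 0)"
    unfolding has_field_derivative_iff by (auto intro: filterlim_at_split[THEN iffD1, THEN conjunct2])
  moreover have "\<forall>\<^sub>F s in at_right 0. (g (x + s *\<^sub>R (y - x)) - g x) / s \<le> g y - g x"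
    using eventually_at_right_less[of "0::real"] eventually_at_right_real[of 0 "1::real", simplified]
  proof eventually_elim
    case (elim s)
    have "g ((1 - s) *\<^sub>R x + s *\<^sub>R y) \<le> (1 - s) * g x + s * g y"
      using elim by (intro convex_onD[OF convex]) auto
    moreover have "(1 - s) *\<^sub>R x + s *\<^sub>R y = x + s *\<^sub>R (y - x)" by (simp add: algebra_simps)
    ultimately show ?case using elim by (simp add: field_simps)
  qed
  ultimately have "inner (grad x) (y - x) \<le> g y - g x"
    by (rule tendsto_upperbound) simp
  then show ?thesis by simp
qed

lemma grad_mono: "inner (grad x - grad y) (x - y) \<ge> 0"
  using above_tangent[of x y] above_tangent[of y x] by (simp add: inner_diff_left inner_diff_right)

text \<open>The quotient of \<open>grad\<close> along the line through \<open>x\<close> in direction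
  \<open>h\<close>, tested with \<open>h\<close>, is nonnegative by monotonicity and tends to the
  quadratic form of the Hessian.\<close>

lemma hess_nonneg: "inner (hess x h) h \<ge> 0"
proof -
  have "((\<lambda>s. grad (x + s *\<^sub>R h)) has_derivative (\<lambda>s. hess (x + 0 *\<^sub>R h) (s *\<^sub>R h))) (at 0)"
    by (rule has_derivative_compose[OF _ hess]) (auto intro!: derivative_eq_intros)
  then have "((\<lambda>s. inner (grad (x + s *\<^sub>R h)) h) has_derivative (\<lambda>s. inner (hess x (s *\<^sub>R h)) h)) (at 0)"
    using has_derivative_inner_left by fastforce
  moreover have "(\<lambda>s. inner (hess x (s *\<^sub>R h)) h) = (*) (inner (hess x h) h)"
    using has_derivative_bounded_linear[OF hess[of x]]
    by (auto simp: linear_cmul bounded_linear.linear)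
  ultimately have "((\<lambda>s. (inner (grad (x + s *\<^sub>R h)) h - inner (grad x) h) / s) \<longlongrightarrow> inner (hess x h) h) (at 0)"
    using has_field_derivative_iff[of "\<lambda>s. inner (grad (x + s *\<^sub>R h)) h" _ 0 UNIV]
    by (simp add: has_field_derivative_def)
  moreover have "(inner (grad (x + s *\<^sub>R h)) h - inner (grad x) h) / s \<ge> 0" for s :: real
  proof (cases "s = 0")
    case False
    have "s * (inner (grad (x + s *\<^sub>R h)) h - inner (grad x) h) \<ge> 0"
      using grad_mono[of "x + s *\<^sub>R h" x] by (simp add: inner_diff_left algebra_simps)
    then show ?thesis using False by (auto simp: zero_le_divide_iff zero_le_mult_iff)
  qed simp
  ultimately show ?thesis
    by (intro tendsto_lowerbound[of _ _ "at (0::real)"]) auto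
qed

lemma argmin_iff: "z \<in> argmin g \<longleftrightarrow> (\<forall>y. g z \<le> g y)"
  by (auto simp: argmin_def is_arg_min_def not_less)

lemma argmin_iff_grad: "z \<in> argmin g \<longleftrightarrow> grad z = 0"
proof
  assume "z \<in> argmin g"
  then have "\<forall>y. g z \<le> g y" by (simp add: argmin_iff)
  then have "(\<lambda>h. inner (grad z) h) = (\<lambda>h. 0)"
    using differential_zero_maxmin[of z UNIV g "\<lambda>h. inner (grad z) h"] g_deriv by auto
  then show "grad z = 0" by (metis inner_eq_zero_iff)
next
  assume "grad z = 0"
  then show "z \<in> argmin g" using above_tangent[of z] by (auto simp: argmin_iff)
qed

end

section \<open>The Tikhonov path: stationarity, speed and limit\<close>

context smooth_convex
begin

text \<open>The parameter is the weight rather than the time, so that time dependence enters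
  afterwards through the chain rule.\<close>

definition tik :: "real \<Rightarrow> 'a"
  where "tik e = arg_min (\<lambda>y. g y + e / 2 * (norm y)\<^sup>2) (\<lambda>_. True)"

text \<open>The quadratic term expands exactly, so the only inequality involved is the tangent
  inequality for \<open>g\<close>.\<close>

lemma tikhonov_strong_convexity:
  "g y + e / 2 * (norm y)\<^sup>2 \<ge> g x + e / 2 * (norm x)\<^sup>2 + inner (grad x + e *\<^sub>R x) (y - x) + e / 2 * (norm (y - x))\<^sup>2"
proof -
  have "e / 2 * (norm y)\<^sup>2 = e / 2 * (norm x)\<^sup>2 + inner (e *\<^sub>R x) (y - x) + e / 2 * (norm (y - x))\<^sup>2"
    unfolding power2_norm_eq_inner
    by (simp add: inner_diff_left inner_diff_right inner_commute field_simps)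
  with above_tangent[of x y] show ?thesis unfolding inner_add_left by linarith
qed

context
  assumes argmin: "argmin g \<noteq> {}"
begin

lemma tik_stationary:
  assumes e: "e > 0"
  shows "grad (tik e) + e *\<^sub>R tik e = 0"
proof -
  define h where "h = (\<lambda>y. g y + e / 2 * (norm y)\<^sup>2)"
  obtain z0 where z0: "\<And>y. g z0 \<le> g y" using argmin argmin_iff by auto
  have "\<exists>z. \<forall>y. h z \<le> h y"
  proof (rule strongly_midpoint_convex_attains_min)
    show "continuous_on UNIV h"
      unfolding h_def by (intro continuous_intros continuous_g)
    show "bdd_below (range h)"
      using z0 e by (intro bdd_belowI2[of _ "g z0"]) (auto simp: h_def intro: add_increasing2)
    \<comment> \<open>The parallelogram identity leaves a quarter of the squared distance, times the
      weight \<open>e / 2\<close>.\<close>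
    show "e / 8 > 0" using e by simp
    fix u v
    have gm: "g ((1/2) *\<^sub>R (u + v)) \<le> (g u + g v) / 2"
      using convex_onD[OF convex, of "1/2" u v] by (simp add: scaleR_add_right)
    have nm: "(norm ((1/2) *\<^sub>R (u + v)))\<^sup>2 = ((norm u)\<^sup>2 + (norm v)\<^sup>2) / 2 - (norm (u - v))\<^sup>2 / 4"
      unfolding power2_norm_eq_inner
      by (simp add: inner_diff_left inner_diff_right inner_add_left inner_add_right inner_commute field_simps)
    have "e / 2 * (norm ((1/2) *\<^sub>R (u + v)))\<^sup>2
        = (e / 2 * (norm u)\<^sup>2 + e / 2 * (norm v)\<^sup>2) / 2 - e / 8 * (norm (u - v))\<^sup>2"
      unfolding nm by (simp add: field_simps)
    with gm show "h ((1/2) *\<^sub>R (u + v)) \<le> (h u + h v) / 2 - e / 8 * (norm (u - v))\<^sup>2"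
      unfolding h_def by argo
  qed
  then obtain z where "\<And>y. h z \<le> h y" by blast
  \<comment> \<open>\<open>tik e\<close> is defined by choice; existence of a minimizer is what
    makes it one.\<close>
  then have "is_arg_min h (\<lambda>_. True) z" by (simp add: is_arg_min_linorder)
  then have "is_arg_min h (\<lambda>_. True) (tik e)"
    unfolding tik_def arg_min_def h_def[symmetric]
    by (rule someI)
  then have min: "h (tik e) \<le> h y" for y by (auto simp: is_arg_min_linorder)
  have "(h has_derivative (\<lambda>k. inner (grad (tik e) + e *\<^sub>R tik e) k)) (at (tik e))"
    unfolding h_def power2_norm_eq_inner
    by (auto intro!: derivative_eq_intros g_deriv simp: inner_add_left inner_add_right inner_commute field_simps)
  then have "(\<lambda>k. inner (grad (tik e) + e *\<^sub>R tik e) k) = (\<lambda>k. 0)"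
    using differential_zero_maxmin[of "tik e" UNIV h] min by auto
  then show ?thesis by (metis inner_eq_zero_iff)
qed

lemma tik_grad: "e > 0 \<Longrightarrow> grad (tik e) = - (e *\<^sub>R tik e)"
  using tik_stationary by (simp add: eq_neg_iff_add_eq_0)

text \<open>Monotonicity of \<open>grad\<close> between two points of the path, with the gradients
  replaced by stationarity. The Lipschitz bound and the comparison of norms along the path both come
  from this inequality.\<close>

lemma tik_monotone:
  assumes "e > 0" "n > 0"
  shows "e * (norm (tik e - tik n))\<^sup>2 \<le> (n - e) * inner (tik n) (tik e - tik n)"
  using grad_mono[of "tik e" "tik n"] assms unfolding tik_grad[OF assms(1)] tik_grad[OF assms(2)]
  by (simp add: power2_norm_eq_inner inner_diff_left inner_diff_right inner_commute algebra_simps)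

lemma tik_lipschitz:
  assumes e: "e > 0" and n: "n > 0"
  shows "norm (tik e - tik n) \<le> \<bar>n - e\<bar> / e * norm (tik n)"
proof (cases "tik e = tik n")
  case False
  have "e * (norm (tik e - tik n))\<^sup>2 \<le> \<bar>n - e\<bar> * \<bar>inner (tik n) (tik e - tik n)\<bar>"
    using tik_monotone[OF e n] by (metis abs_ge_self abs_mult order_trans)
  also have "\<dots> \<le> \<bar>n - e\<bar> * (norm (tik n) * norm (tik e - tik n))"
    by (intro mult_left_mono Cauchy_Schwarz_ineq2) auto
  finally have "(e * norm (tik e - tik n)) * norm (tik e - tik n)
      \<le> (\<bar>n - e\<bar> * norm (tik n)) * norm (tik e - tik n)"
    by (simp add: power2_eq_square mult.assoc)
  then have "e * norm (tik e - tik n) \<le> \<bar>n - e\<bar> * norm (tik n)"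
    using False by (auto dest: mult_right_le_imp_le)
  then show ?thesis using e by (simp add: field_simps)
qed (use assms in auto)

text \<open>Monotonicity of \<open>grad\<close> is tested against a minimizer, where the gradient
  vanishes. This bounds the whole path uniformly.\<close>

lemma tik_norm_le:
  assumes e: "e > 0" and z: "z \<in> argmin g"
  shows "norm (tik e) \<le> norm z"
proof -
  have "inner (- (e *\<^sub>R tik e)) (tik e - z) \<ge> 0"
    using grad_mono[of "tik e" z] z by (simp add: argmin_iff_grad tik_grad[OF e])
  then have "e * (norm (tik e))\<^sup>2 \<le> e * inner (tik e) z"
    by (simp add: power2_norm_eq_inner inner_diff_right algebra_simps)
  then have "(norm (tik e))\<^sup>2 \<le> inner (tik e) z" using e by simp
  also have "\<dots> \<le> norm (tik e) * norm z" by (rule norm_cauchy_schwarz)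
  finally show ?thesis by (cases "tik e = 0") (auto simp: power2_eq_square dest: mult_left_le_imp_le)
qed

text \<open>
  The implicit function theorem would need a continuous Hessian. Here the path is already known to be
  Lipschitz, and coercivity of \<open>hess + e\<close> turns the linearized equation into differentiability.
\<close>

lemma tik_has_vector_derivative:
  assumes e: "e > 0"
  shows "\<exists>D. (tik has_vector_derivative D) (at e) \<and> norm D \<le> norm (tik e) / e"
proof -
  define A where "A = (\<lambda>h. hess (tik e) h + e *\<^sub>R h)"
  have blA: "bounded_linear A"
    unfolding A_def
    by (intro bounded_linear_add has_derivative_bounded_linear[OF hess] bounded_linear_scaleR_right)
  interpret A: bounded_linear A by (rule blA)
  have coer: "e * (norm h)\<^sup>2 \<le> inner (A h) h" for h
    using hess_nonneg[of "tik e" h] by (simp add: A_def inner_add_left power2_norm_eq_inner)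
  have bel: "e * norm h \<le> norm (A h)" for h
  proof -
    have "(e * norm h) * norm h \<le> norm (A h) * norm h"
      using coer[of h] norm_cauchy_schwarz[of "A h" h] by (simp add: power2_eq_square mult.assoc)
    then show ?thesis by (cases "h = 0") (auto dest: mult_right_le_imp_le)
  qed
  \<comment> \<open>Formal differentiation of \<open>grad (tik e) + e *\<^sub>R tik e = 0\<close> in
    \<open>e\<close> gives this equation for the derivative.\<close>
  obtain D where D: "A D = - tik e" using coercive_linear_surj[OF blA e coer] by blast
  have nD: "norm D \<le> norm (tik e) / e"
    using bel[of D] e by (simp add: D field_simps)
  define L where "L = 2 * norm (tik e) / e + 1"
  have L: "L > 0" using e by (simp add: L_def add_nonneg_pos)
  have lip: "norm (tik n - tik e) \<le> L * \<bar>n - e\<bar>" if n: "n > e / 2" for n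
  proof -
    have "norm (tik n - tik e) \<le> \<bar>n - e\<bar> * (norm (tik e) / n)"
      using tik_lipschitz[of n e] n e by (simp add: abs_minus_commute)
    also have "\<dots> \<le> \<bar>n - e\<bar> * L"
    proof (rule mult_left_mono)
      have "norm (tik e) / n \<le> norm (tik e) / (e / 2)"
        using n e by (intro divide_left_mono) auto
      then show "norm (tik e) / n \<le> L" by (simp add: L_def mult.commute)
    qed simp
    finally show ?thesis by (simp add: mult.commute)
  qed
  have "(tik has_vector_derivative D) (at e)"
    unfolding has_vector_derivative_def has_derivative_at_alt
  proof (intro conjI allI impI)
    show "bounded_linear (\<lambda>h. h *\<^sub>R D)" by (rule bounded_linear_scaleR_left)
    fix \<eta> :: real assume \<eta>: "\<eta> > 0"
    \<comment> \<open>Two error terms of size \<open>\<eta>' * L * \<bar>n - e\<bar>\<close> occur,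
      and coercivity divides their sum by \<open>e\<close>.\<close>
    define \<eta>' where "\<eta>' = e * \<eta> / (2 * L)"
    have \<eta>': "\<eta>' > 0" using \<eta> e L by (simp add: \<eta>'_def)
    obtain d where d: "d > 0" "\<And>y. norm (y - tik e) < d \<Longrightarrow>
        norm (grad y - grad (tik e) - hess (tik e) (y - tik e)) \<le> \<eta>' * norm (y - tik e)"
      using hess[of "tik e"] \<eta>' unfolding has_derivative_at_alt by blast
    show "\<exists>d>0. \<forall>n. norm (n - e) < d \<longrightarrow>
        norm (tik n - tik e - (n - e) *\<^sub>R D) \<le> \<eta> * norm (n - e)"
    \<comment> \<open>The three entries keep \<open>n\<close> in the range of the Lipschitz bound,
      keep \<open>tik n\<close> where the expansion of \<open>grad\<close> is valid, and make the
      second order term \<open>(n - e) *\<^sub>R \<Delta>\<close> small.\<close>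
    proof (intro exI[of _ "Min {e / 2, d / L, \<eta>'}"] conjI allI impI)
      show "Min {e / 2, d / L, \<eta>'} > 0" using e d L \<eta>' by simp
      fix n assume "norm (n - e) < Min {e / 2, d / L, \<eta>'}"
      then have n: "\<bar>n - e\<bar> < e / 2" "\<bar>n - e\<bar> < d / L" "\<bar>n - e\<bar> < \<eta>'" by auto
      have n0: "n > e / 2" using n(1) by linarith
      define \<Delta> where "\<Delta> = tik n - tik e"
      define rem where "rem = grad (tik n) - grad (tik e) - hess (tik e) \<Delta>"
      have \<Delta>: "norm \<Delta> \<le> L * \<bar>n - e\<bar>" using lip[OF n0] by (simp add: \<Delta>_def)
      also have "\<dots> < d" using n(2) L by (simp add: field_simps)
      finally have "norm rem \<le> \<eta>' * norm \<Delta>" using d(2) by (simp add: rem_def \<Delta>_def)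
      also have "\<dots> \<le> \<eta>' * (L * \<bar>n - e\<bar>)" using \<Delta> \<eta>' by simp
      finally have rem: "norm rem \<le> \<eta>' * (L * \<bar>n - e\<bar>)" .
      have "hess (tik e) \<Delta> = - (n *\<^sub>R tik n) + e *\<^sub>R tik e - rem"
        using tik_grad[of n] tik_grad[OF e] n0 e by (simp add: rem_def algebra_simps)
      \<comment> \<open>All first order terms cancel by the choice of \<open>D\<close>; what remains
        is a product of two small quantities and the remainder of \<open>grad\<close>.\<close>
      then have "A (\<Delta> - (n - e) *\<^sub>R D) = - ((n - e) *\<^sub>R \<Delta>) - rem"
        unfolding A.diff A.scaleR D by (simp add: A_def \<Delta>_def algebra_simps)
      then have "e * norm (\<Delta> - (n - e) *\<^sub>R D) \<le> norm (- ((n - e) *\<^sub>R \<Delta>) - rem)"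
        using bel[of "\<Delta> - (n - e) *\<^sub>R D"] by simp
      also have "\<dots> \<le> \<bar>n - e\<bar> * norm \<Delta> + norm rem"
        by (metis norm_minus_cancel norm_scaleR norm_triangle_ineq4)
      also have "\<dots> \<le> \<eta>' * (L * \<bar>n - e\<bar>) + \<eta>' * (L * \<bar>n - e\<bar>)"
        using n(3) \<Delta> rem \<eta>' by (intro add_mono mult_mono) auto
      also have "\<dots> = e * (\<eta> * \<bar>n - e\<bar>)" using L by (simp add: \<eta>'_def field_simps)
      finally show "norm (tik n - tik e - (n - e) *\<^sub>R D) \<le> \<eta> * norm (n - e)"
        using e by (simp add: \<Delta>_def)
    qed
  qed
  then show ?thesis using nD by blast
qed

text \<open>Monotonicity gives \<open>inner (tik n) (tik e - tik n)\<close> a nonnegative sign, and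
  expanding the square finishes. In particular the norm grows as the weight decreases.\<close>

lemma tik_dist_sq:
  assumes "0 < e" "e < n"
  shows "(norm (tik e - tik n))\<^sup>2 \<le> (norm (tik e))\<^sup>2 - (norm (tik n))\<^sup>2"
proof -
  have "0 \<le> e * (norm (tik e - tik n))\<^sup>2" using assms by simp
  also have "\<dots> \<le> (n - e) * inner (tik n) (tik e - tik n)" using tik_monotone[of e n] assms by simp
  finally have "inner (tik n) (tik e - tik n) \<ge> 0" using assms by (simp add: zero_le_mult_iff)
  then show ?thesis
    by (simp add: power2_norm_eq_inner inner_diff_left inner_diff_right inner_commute)
qed

text \<open>Squared norms along the path are bounded and monotone, and they dominate squared
  distances, so the path is Cauchy at 0. Its limit has zero gradient by continuity and inherits the
  norm bound against every minimizer.\<close>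

lemma tik_tendsto_min_norm:
  obtains z where "z \<in> argmin g" "\<And>w. w \<in> argmin g \<Longrightarrow> norm z \<le> norm w"
    "(tik \<longlongrightarrow> z) (at_right 0)"
proof -
  define S where "S = (SUP e\<in>{0<..}. (norm (tik e))\<^sup>2)"
  obtain z0 where z0: "z0 \<in> argmin g" using argmin by blast
  have bdd: "bdd_above ((\<lambda>e. (norm (tik e))\<^sup>2) ` {0<..})"
    by (rule bdd_aboveI2[of _ _ "(norm z0)\<^sup>2"]) (auto intro!: power_mono tik_norm_le z0)
  have S: "(norm (tik e))\<^sup>2 \<le> S" if "e > 0" for e
    unfolding S_def using that by (intro cSUP_upper bdd) auto
  \<comment> \<open>\<open>n\<close> is chosen so that the squared norm of \<open>tik n\<close> lies
    within \<open>\<epsilon>\<^sup>2\<close> of its supremum.\<close>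
  have near: "\<exists>n>0. \<forall>e. 0 < e \<and> e < n \<longrightarrow> norm (tik e - tik n) < \<epsilon>" if "\<epsilon> > 0" for \<epsilon>
  proof -
    have "S - \<epsilon>\<^sup>2 < S" using that by simp
    then obtain n where n: "n > 0" "S - \<epsilon>\<^sup>2 < (norm (tik n))\<^sup>2"
      unfolding S_def using less_cSUP_iff[OF _ bdd] by (auto simp: S_def)
    have "norm (tik e - tik n) < \<epsilon>" if "0 < e" "e < n" for e
    proof (rule power_less_imp_less_base[of _ 2])
      show "(norm (tik e - tik n))\<^sup>2 < \<epsilon>\<^sup>2" using tik_dist_sq[OF that] S[OF that(1)] n by linarith
    qed (use \<open>\<epsilon> > 0\<close> in simp)
    then show ?thesis using n by blast
  qed
  \<comment> \<open>Completeness is used along the weights \<open>1 / (k + 1)\<close>; the estimate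
    \<open>near\<close> then transfers the limit to the whole path.\<close>
  have "Cauchy (\<lambda>k. tik (1 / real (Suc k)))"
  proof (rule metric_CauchyI)
    fix \<epsilon> :: real assume "\<epsilon> > 0"
    then obtain n where n: "n > 0" "\<And>e. 0 < e \<Longrightarrow> e < n \<Longrightarrow> norm (tik e - tik n) < \<epsilon> / 2"
      using near[of "\<epsilon> / 2"] by auto
    obtain N where N: "1 / real (Suc N) < n" using nat_approx_posE[OF n(1)] by blast
    have "norm (tik (1 / real (Suc k)) - tik n) < \<epsilon> / 2" if "k \<ge> N" for k
    proof (rule n(2))
      have "1 / real (Suc k) \<le> 1 / real (Suc N)" using that by (simp add: frac_le)
      then show "1 / real (Suc k) < n" using N by linarith
    qed simp
    then show "\<exists>M. \<forall>m\<ge>M. \<forall>k\<ge>M. dist (tik (1 / real (Suc m))) (tik (1 / real (Suc k))) < \<epsilon>"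
      by (metis dist_norm dist_triangle_half_l)
  qed
  then obtain z where z: "(\<lambda>k. tik (1 / real (Suc k))) \<longlonglongrightarrow> z"
    using Cauchy_convergent_iff convergent_def by blast
  have lim: "(tik \<longlongrightarrow> z) (at_right 0)"
  proof (rule tendstoI)
    fix \<epsilon> :: real assume "\<epsilon> > 0"
    then obtain n where n: "n > 0" "\<And>e. 0 < e \<Longrightarrow> e < n \<Longrightarrow> norm (tik e - tik n) < \<epsilon> / 3"
      using near[of "\<epsilon> / 3"] by auto
    have "\<forall>\<^sub>F k in sequentially. 1 / real (Suc k) < n"
      using order_tendstoD(2)[OF LIMSEQ_Suc[OF lim_1_over_n] n(1)] .
    moreover have "\<forall>\<^sub>F k in sequentially. dist (tik (1 / real (Suc k))) z < \<epsilon> / 3"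
      by (rule tendstoD[OF z]) (use \<open>\<epsilon> > 0\<close> in simp)
    ultimately obtain k where k: "1 / real (Suc k) < n" "dist (tik (1 / real (Suc k))) z < \<epsilon> / 3"
      using eventually_conj eventually_happens' sequentially_bot by (metis (mono_tags, lifting))
    have k': "norm (tik (1 / real (Suc k)) - tik n) < \<epsilon> / 3" by (rule n(2)) (use k in auto)
    have "dist (tik e) z < \<epsilon>" if "0 < e" "e < n" for e
    proof -
      have "dist (tik e) (tik n) < \<epsilon> / 3" "dist (tik (1 / real (Suc k))) (tik n) < \<epsilon> / 3"
        using n(2)[OF that] k' by (auto simp: dist_norm)
      then show ?thesis
        using k(2) dist_triangle[of "tik e" z "tik n"]
          dist_triangle3[of "tik n" z "tik (1 / real (Suc k))"] by linarith
    qed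
    then show "\<forall>\<^sub>F e in at_right 0. dist (tik e) z < \<epsilon>"
      unfolding eventually_at_right_field using n(1) by auto
  qed
  have pos: "\<forall>\<^sub>F e in at_right 0. (0::real) < e" by (simp add: eventually_at_right_less)
  have "grad z = 0"
  proof (rule tendsto_unique[of "at_right (0::real)"])
    show "((\<lambda>e. grad (tik e)) \<longlongrightarrow> grad z) (at_right 0)"
      by (rule isCont_tendsto_compose[OF isCont_grad lim])
    have "((\<lambda>e. - (e *\<^sub>R tik e)) \<longlongrightarrow> - (0 *\<^sub>R z)) (at_right 0)"
      by (intro tendsto_intros lim)
    then have "((\<lambda>e. - (e *\<^sub>R tik e)) \<longlongrightarrow> 0) (at_right 0)" by simp
    then show "((\<lambda>e. grad (tik e)) \<longlongrightarrow> 0) (at_right 0)"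
      by (rule Lim_transform_eventually[OF _ eventually_mono[OF pos]]) (simp_all add: tik_grad)
  qed simp
  then have zin: "z \<in> argmin g" by (simp add: argmin_iff_grad)
  have "norm z \<le> norm w" if "w \<in> argmin g" for w
    by (rule tendsto_upperbound[OF tendsto_norm[OF lim] eventually_mono[OF pos]])
      (use that in \<open>auto intro: tik_norm_le\<close>)
  then show ?thesis by (intro that[of z] zin lim)
qed

text \<open>The projection is a choice, so uniqueness has to be shown: the midpoint of two
  minimizers of least norm is again a minimizer, and by the parallelogram identity it would be
  shorter than both unless they coincide.\<close>

lemma metric_proj_argmin:
  assumes z: "z \<in> argmin g" and zmin: "\<And>w. w \<in> argmin g \<Longrightarrow> norm z \<le> norm w"
  shows "metric_proj (argmin g) 0 = z"
proof -
  define w where "w = metric_proj (argmin g) 0"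
  have "is_arg_min (dist 0) (\<lambda>x. x \<in> argmin g) w"
    unfolding w_def metric_proj_def arg_min_on_def arg_min_def
    by (rule someI[where P = "is_arg_min (dist 0) (\<lambda>x. x \<in> argmin g)" and x = z])
      (use z zmin in \<open>auto simp: is_arg_min_linorder\<close>)
  then have w: "w \<in> argmin g" "norm w \<le> norm z"
    using z by (auto simp: is_arg_min_linorder)
  have "g ((1/2) *\<^sub>R (w + z)) \<le> (g w + g z) / 2"
    using convex_onD[OF convex, of "1/2" w z] by (simp add: scaleR_add_right)
  moreover have "(g w + g z) / 2 \<le> g y" for y
  proof -
    have "g w \<le> g y" "g z \<le> g y" using w(1) z by (auto simp: argmin_iff)
    then show ?thesis by simp
  qed
  ultimately have "(1/2) *\<^sub>R (w + z) \<in> argmin g"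
    unfolding argmin_iff by (meson order_trans)
  then have "(norm z)\<^sup>2 \<le> (norm ((1/2) *\<^sub>R (w + z)))\<^sup>2"
    by (intro power_mono zmin) simp_all
  also have "\<dots> = ((norm w)\<^sup>2 + (norm z)\<^sup>2) / 2 - (norm (w - z))\<^sup>2 / 4"
    unfolding power2_norm_eq_inner
    by (simp add: inner_diff_left inner_diff_right inner_add_left inner_add_right inner_commute field_simps)
  finally have "(norm (w - z))\<^sup>2 / 4 \<le> ((norm w)\<^sup>2 - (norm z)\<^sup>2) / 2" by (simp add: field_simps)
  moreover have "(norm w)\<^sup>2 \<le> (norm z)\<^sup>2" using w(2) by (simp add: power_mono)
  ultimately have "(norm (w - z))\<^sup>2 \<le> 0" by argo
  then show ?thesis unfolding w_def by simp
qed

end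

end

section \<open>Decay of the energy\<close>

text \<open>\<open>M * t powr (-s)\<close> is a supersolution for large \<open>M\<close>: since
  \<open>m < 1\<close>, its derivative is of lower order than the damping term. The difference
  \<open>F\<close>, multiplied by the integrating factor, is nonincreasing and starts
  nonpositive.\<close>

lemma power_decay_of_differential_inequality:
  fixes E E' :: "real \<Rightarrow> real"
  assumes m: "m < 1" and c: "c > 0" and C: "C \<ge> 0" and s: "s \<ge> 0"
    and der: "\<forall>\<^sub>F t in at_top. (E has_real_derivative E' t) (at t)"
    and ineq: "\<forall>\<^sub>F t in at_top. E' t \<le> - c * t powr (-m) * E t + C * t powr (-m - s)"
  shows "\<exists>M>0. \<forall>\<^sub>F t in at_top. E t \<le> M * t powr (-s)"
proof -
  have "((\<lambda>t. s * t powr (m - 1)) \<longlongrightarrow> s * 0) at_top"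
    using m by (intro tendsto_mult tendsto_const tendsto_neg_powr filterlim_ident) auto
  then have "\<forall>\<^sub>F t in at_top. s * t powr (m - 1) < c / 2"
    using c by (intro order_tendstoD(2)) auto
  then have "\<forall>\<^sub>F t in at_top. t > 0 \<and> s * t powr (m - 1) < c / 2 \<and> (E has_real_derivative E' t) (at t)
      \<and> E' t \<le> - c * t powr (-m) * E t + C * t powr (-m - s)"
    using eventually_gt_at_top[of 0] der ineq by eventually_elim auto
  then obtain T where T: "\<And>t. t \<ge> T \<Longrightarrow> t > 0" "\<And>t. t \<ge> T \<Longrightarrow> s * t powr (m - 1) < c / 2"
      "\<And>t. t \<ge> T \<Longrightarrow> (E has_real_derivative E' t) (at t)"
      "\<And>t. t \<ge> T \<Longrightarrow> E' t \<le> - c * t powr (-m) * E t + C * t powr (-m - s)"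
    unfolding eventually_at_top_linorder by auto
  have T0: "T > 0" using T(1) by simp
  \<comment> \<open>The first entry lets half of the damping absorb the source, the second makes
    \<open>F T\<close> nonpositive, and the \<open>+ 1\<close> gives positivity.\<close>
  define M where "M = max (2 * C / c) (\<bar>E T\<bar> * T powr s) + 1"
  have M: "2 * C \<le> c * M" "\<bar>E T\<bar> * T powr s \<le> M"
    using c unfolding M_def by (auto simp: field_simps max_def)
  have M0: "M > 0" using C c unfolding M_def by (simp add: add_nonneg_pos le_max_iff_disj)
  define F where "F = (\<lambda>t. E t - M * t powr (-s))"
  define P where "P = (\<lambda>t. exp (c * t powr (1 - m) / (1 - m)) * F t)"
  have "P t \<le> P T" if "T \<le> t" for t
  proof (rule DERIV_nonpos_imp_nonincreasing[OF that])
    fix u assume u: "T \<le> u" "u \<le> t"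
    then have u0: "u > 0" using T(1) by simp
    define dF where "dF = E' u - M * (-s * u powr (-s - 1))"
    have dF: "(F has_real_derivative dF) (at u)"
      unfolding F_def dF_def using u0 by (auto intro!: derivative_eq_intros T(3)[OF u(1)])
    have "((\<lambda>t. c * t powr (1 - m) / (1 - m)) has_real_derivative c * u powr (-m)) (at u)"
      using u0 m by (auto intro!: derivative_eq_intros)
    from DERIV_mult[OF DERIV_fun_exp[OF this] dF]
    have "(P has_real_derivative exp (c * u powr (1 - m) / (1 - m)) * (c * u powr (-m) * F u + dF)) (at u)"
      unfolding P_def by (simp add: algebra_simps)
    moreover have "c * u powr (-m) * F u + dF \<le> 0"
    proof -
      have e1: "u powr (-s - 1) = u powr (-m - s) * u powr (m - 1)"
        and e2: "u powr (-m) * u powr (-s) = u powr (-m - s)"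
        by (simp_all add: powr_add[symmetric])
      have "c * u powr (-m) * F u + dF
          = (E' u + c * u powr (-m) * E u) - c * M * (u powr (-m) * u powr (-s)) + M * s * u powr (-s - 1)"
        by (simp add: F_def dF_def algebra_simps)
      also have "\<dots> \<le> C * u powr (-m - s) - c * M * u powr (-m - s)
          + M * (s * u powr (m - 1)) * u powr (-m - s)"
      proof -
        have "E' u + c * u powr (-m) * E u \<le> C * u powr (-m - s)" using T(4)[OF u(1)] by simp
        moreover have "M * s * u powr (-s - 1) = M * (s * u powr (m - 1)) * u powr (-m - s)"
          by (simp add: e1)
        moreover have "c * M * (u powr (-m) * u powr (-s)) = c * M * u powr (-m - s)"
          by (simp only: e2)
        ultimately show ?thesis by linarith
      qed
      also have "\<dots> = (C - c * M + M * (s * u powr (m - 1))) * u powr (-m - s)"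
        by (simp add: algebra_simps)
      also have "\<dots> \<le> 0"
      proof (rule mult_nonpos_nonneg)
        have "M * (s * u powr (m - 1)) \<le> M * (c / 2)"
          using T(2)[OF u(1)] M0 by (intro mult_left_mono) auto
        then show "C - c * M + M * (s * u powr (m - 1)) \<le> 0" using M(1) by (simp add: mult.commute[of M])
      qed simp
      finally show ?thesis .
    qed
    ultimately show "\<exists>d. (P has_real_derivative d) (at u) \<and> d \<le> 0"
      by (meson exp_ge_zero mult_nonneg_nonpos)
  qed
  moreover have "P T \<le> 0"
  proof -
    have "E T \<le> \<bar>E T\<bar> * (T powr s * T powr (-s))"
      using T0 by (simp add: powr_add[symmetric])
    also have "\<dots> \<le> M * T powr (-s)"
      using mult_right_mono[OF M(2), of "T powr (-s)"] by (simp add: mult.assoc)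
    finally have "F T \<le> 0" by (simp add: F_def)
    then show ?thesis by (simp add: P_def mult_nonneg_nonpos)
  qed
  ultimately have "P t \<le> 0" if "t \<ge> T" for t
    using that by (meson order_trans)
  then have "F t \<le> 0" if "t \<ge> T" for t
    using that unfolding P_def mult_le_0_iff by (meson exp_gt_zero not_less)
  then have "\<forall>\<^sub>F t in at_top. E t \<le> M * t powr (-s)"
    unfolding eventually_at_top_linorder F_def by auto
  then show ?thesis using M0 by blast
qed

lemma weighted_inner_le:
  fixes u v :: "'a::real_inner"
  assumes "k > 0"
  shows "2 * inner u v \<le> k * (norm u)\<^sup>2 + (norm v)\<^sup>2 / k"
proof -
  have "0 \<le> (norm (k *\<^sub>R u - v))\<^sup>2 / k" using assms by simp
  also have "\<dots> = k * (norm u)\<^sup>2 - 2 * inner u v + (norm v)\<^sup>2 / k"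
    unfolding power2_norm_eq_inner using assms
    by (simp add: inner_diff_left inner_diff_right inner_commute field_simps)
  finally show ?thesis by simp
qed

text \<open>Pure algebra at a frozen time: primed letters stand for time derivatives,
  \<open>2 * b\<close> is the viscous damping and \<open>r\<close> is the logarithmic decay rate of
  \<open>b\<close>. The terms \<open>inner w x'\<close> and \<open>inner y G\<close> cancel. The
  dissipation \<open>\<beta> * \<delta> * (norm G)\<^sup>2\<close> is spent in two halves on the
  remaining products with \<open>G\<close>, except \<open>inner w G\<close>, which is itself
  dissipative.\<close>

lemma lyapunov_dissipation:
  fixes x \<xi> y G \<xi>' w x' w' y' :: "'a::real_inner"
  assumes pos: "\<delta> > 0" "b > 0" "\<beta> > 0" "\<epsilon> \<ge> 0" "r \<ge> 0"
    and \<epsilon>': "\<epsilon>' \<le> - \<beta> * \<epsilon>\<^sup>2"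
    and \<phi>: "\<phi> + \<epsilon> / 2 * (norm (x - \<xi>))\<^sup>2 \<le> inner G (x - \<xi>)"
    and w: "w = b *\<^sub>R (x - \<xi>)"
    and x': "x' = y - \<beta> *\<^sub>R G + (\<beta> * \<epsilon>) *\<^sub>R x"
    and w': "w' = - r *\<^sub>R w + b *\<^sub>R (x' - \<xi>')"
    and y': "y' = - (2 * b) *\<^sub>R x' - \<delta> *\<^sub>R G"
  shows "\<delta>' * \<phi> + \<delta> * (inner G x' + \<epsilon>' / 2 * ((norm x)\<^sup>2 - (norm \<xi>)\<^sup>2)) + inner (w + y) (w' + y') + inner w w'
    \<le> \<delta>' * \<phi> - \<delta> * \<epsilon>' / 2 * (norm \<xi>)\<^sup>2 - b * (\<delta> * \<phi>) - \<delta> * \<epsilon> / (2 * b) * (norm w)\<^sup>2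
      - b * (norm y)\<^sup>2 + \<beta> * b\<^sup>2 / (2 * \<delta>) * (norm y)\<^sup>2 + (\<beta> * \<epsilon> + r) * (norm y * norm w)
      + b * (\<beta> * \<epsilon>) * (norm y * norm \<xi>) + b * ((2 * norm w + norm y) * norm \<xi>')"
proof -
  have bx: "b *\<^sub>R x = w + b *\<^sub>R \<xi>" by (simp add: w algebra_simps)
  have id1: "inner (w + y) (w' + y') + inner w w'
      = - 2 * r * (norm w)\<^sup>2 - r * inner y w - b * inner y x' - b * inner (2 *\<^sub>R w + y) \<xi>'
        - \<delta> * inner w G - \<delta> * inner y G"
    unfolding w' y' power2_norm_eq_inner
    by (simp add: inner_add_left inner_add_right inner_diff_right inner_commute algebra_simps)
  have id2: "inner G x' = inner y G - \<beta> * (norm G)\<^sup>2 + \<beta> * \<epsilon> * inner G x"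
    unfolding x' power2_norm_eq_inner
    by (simp add: inner_add_right inner_diff_right inner_commute)
  have "b * inner y x = inner y w + b * inner y \<xi>"
    using arg_cong[OF bx, of "inner y"] by (simp add: inner_add_right)
  then have id3: "b * inner y x' = b * (norm y)\<^sup>2 - \<beta> * inner G (b *\<^sub>R y) + \<beta> * \<epsilon> * inner y w + b * (\<beta> * \<epsilon>) * inner y \<xi>"
    unfolding x' power2_norm_eq_inner
    by (simp add: inner_add_right inner_diff_right inner_commute algebra_simps)
  have B1: "\<delta> * (\<beta> * \<epsilon> * inner G x) \<le> \<beta> * \<delta> / 2 * (norm G)\<^sup>2 + \<beta> * \<delta> / 2 * (\<epsilon>\<^sup>2 * (norm x)\<^sup>2)"
  proof -
    have "\<beta> * \<delta> / 2 * (2 * inner G (\<epsilon> *\<^sub>R x)) \<le> \<beta> * \<delta> / 2 * (1 * (norm G)\<^sup>2 + (norm (\<epsilon> *\<^sub>R x))\<^sup>2 / 1)"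
      using weighted_inner_le[of 1 G "\<epsilon> *\<^sub>R x"] pos by (intro mult_left_mono) auto
    then show ?thesis by (simp add: power_mult_distrib algebra_simps)
  qed
  have B2: "\<beta> * inner G (b *\<^sub>R y) \<le> \<beta> * \<delta> / 2 * (norm G)\<^sup>2 + \<beta> * b\<^sup>2 / (2 * \<delta>) * (norm y)\<^sup>2"
  proof -
    have "\<beta> / 2 * (2 * inner G (b *\<^sub>R y)) \<le> \<beta> / 2 * (\<delta> * (norm G)\<^sup>2 + (norm (b *\<^sub>R y))\<^sup>2 / \<delta>)"
      using weighted_inner_le[of \<delta> G "b *\<^sub>R y"] pos by (intro mult_left_mono) auto
    then show ?thesis by (simp add: power_mult_distrib algebra_simps)
  qed
  \<comment> \<open>The growth hypothesis enters here: the decrease of the weight pays for the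
    square left over by \<open>B1\<close>.\<close>
  have B3: "\<delta> * (\<epsilon>' / 2 * (norm x)\<^sup>2) + \<beta> * \<delta> / 2 * (\<epsilon>\<^sup>2 * (norm x)\<^sup>2) \<le> 0"
  proof -
    have "(\<delta> / 2 * (norm x)\<^sup>2) * (\<epsilon>' + \<beta> * \<epsilon>\<^sup>2) \<le> 0"
      using pos \<epsilon>' by (intro mult_nonneg_nonpos) auto
    then show ?thesis by (simp add: algebra_simps)
  qed
  \<comment> \<open>Strong convexity turns \<open>inner w G\<close> into damping of both the value
    gap and the distance; the division by \<open>b\<close> comes from writing the distance through
    \<open>w\<close>.\<close>
  have B4: "b * (\<delta> * \<phi>) + \<delta> * \<epsilon> / (2 * b) * (norm w)\<^sup>2 \<le> \<delta> * inner w G"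
  proof -
    have "(b * \<delta>) * (\<phi> + \<epsilon> / 2 * (norm (x - \<xi>))\<^sup>2) \<le> (b * \<delta>) * inner G (x - \<xi>)"
      using \<phi> pos by (intro mult_left_mono) auto
    moreover have "(b * \<delta>) * (\<epsilon> / 2 * (norm (x - \<xi>))\<^sup>2) = \<delta> * \<epsilon> / (2 * b) * (norm w)\<^sup>2"
    proof -
      have "(norm w)\<^sup>2 = b\<^sup>2 * (norm (x - \<xi>))\<^sup>2" by (simp add: w power_mult_distrib)
      then show ?thesis using pos by (simp add: power2_eq_square)
    qed
    ultimately show ?thesis by (simp add: w inner_commute algebra_simps)
  qed
  have cs: "- inner u v \<le> norm u * norm v" for u v :: 'a
    using norm_cauchy_schwarz[of "- u" v] by simp
  have B5: "- (\<beta> * \<epsilon> + r) * inner y w \<le> (\<beta> * \<epsilon> + r) * (norm y * norm w)"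
    using mult_left_mono[OF cs[of y w], of "\<beta> * \<epsilon> + r"] pos by (simp add: algebra_simps)
  have B6: "- (b * (\<beta> * \<epsilon>)) * inner y \<xi> \<le> b * (\<beta> * \<epsilon>) * (norm y * norm \<xi>)"
    using mult_left_mono[OF cs[of y \<xi>], of "b * (\<beta> * \<epsilon>)"] pos by simp
  have B7: "- b * inner (2 *\<^sub>R w + y) \<xi>' \<le> b * ((2 * norm w + norm y) * norm \<xi>')"
  proof -
    have "- inner (2 *\<^sub>R w + y) \<xi>' \<le> norm (2 *\<^sub>R w + y) * norm \<xi>'" by (rule cs)
    also have "\<dots> \<le> (2 * norm w + norm y) * norm \<xi>'"
      using norm_triangle_ineq[of "2 *\<^sub>R w" y] by (intro mult_right_mono) auto
    finally show ?thesis using mult_left_mono[of _ _ b] pos by fastforce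
  qed
  have B8: "- 2 * r * (norm w)\<^sup>2 \<le> 0" using pos by simp
  have "\<delta>' * \<phi> + \<delta> * (inner G x' + \<epsilon>' / 2 * ((norm x)\<^sup>2 - (norm \<xi>)\<^sup>2)) + inner (w + y) (w' + y') + inner w w'
      = \<delta>' * \<phi> - \<delta> * \<epsilon>' / 2 * (norm \<xi>)\<^sup>2 + (- 2 * r * (norm w)\<^sup>2) - (\<beta> * \<delta> / 2 * (norm G)\<^sup>2 + \<beta> * \<delta> / 2 * (norm G)\<^sup>2)
        + \<delta> * (\<beta> * \<epsilon> * inner G x) + \<delta> * (\<epsilon>' / 2 * (norm x)\<^sup>2)
        + (- (\<beta> * \<epsilon> + r) * inner y w) - b * (norm y)\<^sup>2 + \<beta> * inner G (b *\<^sub>R y)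
        + (- (b * (\<beta> * \<epsilon>)) * inner y \<xi>) + (- b * inner (2 *\<^sub>R w + y) \<xi>') - \<delta> * inner w G"
    using id1 id3 unfolding id2 by (simp add: algebra_simps)
  then show ?thesis
    using B1 B2 B3 B4 B5 B6 B7 B8 by linarith
qed

section \<open>The first order flow in position and momentum, and its energy\<close>

locale tikhonov_flow = smooth_convex g grad hess
  for g :: "'a::{real_inner, complete_space} \<Rightarrow> real" and grad hess +
  fixes t0 \<alpha> \<beta> a p q :: real and \<delta> \<delta>' :: "real \<Rightarrow> real" and x y :: "real \<Rightarrow> 'a"
  assumes argmin_ne: "argmin g \<noteq> {}"
    and t0: "t0 > 0"
    and params: "\<alpha> > 0" "\<beta> > 0" "a > 0" "p > 0" "0 < q" "q < 1"
    and \<delta>_pos: "\<And>t. t \<ge> t0 \<Longrightarrow> \<delta> t > 0"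
    and \<delta>_deriv: "\<And>t. t > t0 \<Longrightarrow> (\<delta> has_real_derivative \<delta>' t) (at t)"
    and \<delta>_lim: "filterlim \<delta> at_top at_top"
    and pq: "q < p" "p < q + 1"
    and growth: "\<And>t. t \<ge> t0 \<Longrightarrow> t powr p * \<delta>' t + p * t powr (p - 1) * \<delta> t - a * \<beta> \<ge> 0"
    and K1: "\<exists>K1>0. \<forall>\<^sub>F t in at_top. t * \<delta>' t < K1 * \<delta> t"
    and x_deriv: "\<And>t. t > t0 \<Longrightarrow> (x has_vector_derivative y t - \<beta> *\<^sub>R grad (x t)) (at t)"
    and y_deriv: "\<And>t. t > t0 \<Longrightarrow> (y has_vector_derivative
      - ((\<alpha> / t powr q) *\<^sub>R (y t - \<beta> *\<^sub>R grad (x t)) + \<delta> t *\<^sub>R grad (x t) + (a / t powr p) *\<^sub>R x t)) (at t)"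
begin

definition \<epsilon> :: "real \<Rightarrow> real" where "\<epsilon> t = a / (\<delta> t * t powr p)"

text \<open>The derivative of \<open>\<epsilon>\<close> in logarithmic form, since the speed of
  \<open>\<xi>\<close> is governed by the ratio of \<open>\<epsilon>'\<close> to
  \<open>\<epsilon>\<close>.\<close>

definition \<epsilon>' :: "real \<Rightarrow> real" where "\<epsilon>' t = - \<epsilon> t * (\<delta>' t / \<delta> t + p / t)"

definition \<xi> :: "real \<Rightarrow> 'a" where "\<xi> t = tik (\<epsilon> t)"

definition b :: "real \<Rightarrow> real" where "b t = \<alpha> / 2 * t powr (-q)"

definition w :: "real \<Rightarrow> 'a" where "w t = b t *\<^sub>R (x t - \<xi> t)"

definition \<phi> :: "real \<Rightarrow> real"
  where "\<phi> t = (g (x t) + \<epsilon> t / 2 * (norm (x t))\<^sup>2) - (g (\<xi> t) + \<epsilon> t / 2 * (norm (\<xi> t))\<^sup>2)"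

definition energy :: "real \<Rightarrow> real"
  where "energy t = \<delta> t * \<phi> t + (norm (w t + y t))\<^sup>2 / 2 + (norm (w t))\<^sup>2 / 2"

lemma \<epsilon>_pos: "t \<ge> t0 \<Longrightarrow> \<epsilon> t > 0"
  using \<delta>_pos t0 params by (simp add: \<epsilon>_def)

lemma \<delta>_\<epsilon>: "t \<ge> t0 \<Longrightarrow> \<delta> t * \<epsilon> t = a * t powr (-p)"
  using \<delta>_pos[of t] t0 by (simp add: \<epsilon>_def powr_minus field_simps)

lemma b_pos: "t > 0 \<Longrightarrow> b t > 0"
  using params by (simp add: b_def)

lemma deriv_scale:
  assumes t: "t > t0"
  shows "((\<lambda>t. \<delta> t * t powr p) has_real_derivative t powr p * \<delta>' t + p * t powr (p - 1) * \<delta> t) (at t)"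
  using t t0 by (auto intro!: derivative_eq_intros \<delta>_deriv)

lemma \<epsilon>_deriv:
  assumes t: "t > t0"
  shows "(\<epsilon> has_real_derivative \<epsilon>' t) (at t)"
proof -
  have t': "t > 0" "\<delta> t > 0" using t t0 \<delta>_pos[of t] by auto
  have "(\<epsilon> has_real_derivative - (a * (t powr p * \<delta>' t + p * t powr (p - 1) * \<delta> t)) / (\<delta> t * t powr p)\<^sup>2) (at t)"
    using DERIV_divide[OF DERIV_const[of a] deriv_scale[OF t]] t'
    by (simp add: \<epsilon>_def[abs_def] power2_eq_square)
  also have "- (a * (t powr p * \<delta>' t + p * t powr (p - 1) * \<delta> t)) / (\<delta> t * t powr p)\<^sup>2 = \<epsilon>' t"
    using t' unfolding \<epsilon>'_def \<epsilon>_def by (simp add: powr_diff power2_eq_square field_simps)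
  finally show ?thesis .
qed

text \<open>The difference of the two sides is the growth expression times a negative
  factor.\<close>

lemma \<epsilon>'_le:
  assumes t: "t > t0"
  shows "\<epsilon>' t \<le> - \<beta> * (\<epsilon> t)\<^sup>2"
proof -
  have t': "t > 0" "\<delta> t > 0" using t t0 \<delta>_pos[of t] by auto
  have "\<epsilon>' t + \<beta> * (\<epsilon> t)\<^sup>2
      = - (a / (\<delta> t * t powr p)\<^sup>2) * (t powr p * \<delta>' t + p * t powr (p - 1) * \<delta> t - a * \<beta>)"
    using t' unfolding \<epsilon>'_def \<epsilon>_def by (simp add: powr_diff power2_eq_square field_simps)
  also have "\<dots> \<le> 0"
    using growth[of t] t t' params by (intro mult_nonpos_nonneg) auto
  finally show ?thesis by simp
qed

lemma \<epsilon>'_nonpos: "t > t0 \<Longrightarrow> \<epsilon>' t \<le> 0"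
  using \<epsilon>'_le[of t] params by (smt (verit) mult_nonneg_nonneg zero_le_power2 mult_minus_left)

text \<open>Integrated, the growth hypothesis says that
  \<open>\<delta> t * t powr p - a * \<beta> * t\<close> is nondecreasing, so
  \<open>\<delta> t * t powr p\<close> grows at least linearly.\<close>

lemma \<epsilon>_le: "\<forall>\<^sub>F t in at_top. \<beta> * \<epsilon> t \<le> 2 / t"
  using eventually_ge_at_top[of "2 * (t0 + 1)"]
proof eventually_elim
  case (elim t)
  \<comment> \<open>The comparison starts after \<open>t0\<close>, where two-sided derivatives
    exist; \<open>s \<le> t / 2\<close> gives the factor 2 in the conclusion.\<close>
  define s where "s = t0 + 1"
  have s: "t0 < s" "s \<le> t" "t > 0" "s \<le> t / 2" using elim t0 by (auto simp: s_def)
  have "\<delta> s * s powr p - a * \<beta> * s \<le> \<delta> t * t powr p - a * \<beta> * t"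
  proof (rule DERIV_nonneg_imp_nondecreasing[OF s(2)])
    fix u assume "s \<le> u" "u \<le> t"
    then have "u > t0" using s by simp
    from DERIV_diff[OF deriv_scale[OF this] DERIV_cmult_Id[of "a * \<beta>"]]
    have "((\<lambda>t. \<delta> t * t powr p - a * \<beta> * t) has_real_derivative
        u powr p * \<delta>' u + p * u powr (p - 1) * \<delta> u - a * \<beta>) (at u)" .
    then show "\<exists>d. ((\<lambda>t. \<delta> t * t powr p - a * \<beta> * t) has_real_derivative d) (at u) \<and> 0 \<le> d"
      using growth[of u] \<open>u > t0\<close> by auto
  qed
  moreover have "\<delta> s * s powr p \<ge> 0" using \<delta>_pos[of s] s by simp
  moreover have "a * \<beta> * s \<le> a * \<beta> * (t / 2)" using s params by (intro mult_left_mono) auto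
  ultimately have "a * \<beta> * t / 2 \<le> \<delta> t * t powr p" by argo
  then show ?case
    using s params \<delta>_pos[of t] by (simp add: \<epsilon>_def field_simps)
qed

lemma \<xi>_norm_le: "t \<ge> t0 \<Longrightarrow> z \<in> argmin g \<Longrightarrow> norm (\<xi> t) \<le> norm z"
  using tik_norm_le[OF argmin_ne \<epsilon>_pos] by (simp add: \<xi>_def)

lemma \<xi>_grad: "t \<ge> t0 \<Longrightarrow> grad (\<xi> t) + \<epsilon> t *\<^sub>R \<xi> t = 0"
  using tik_stationary[OF argmin_ne \<epsilon>_pos] by (simp add: \<xi>_def)

text \<open>In the chain rule the factor \<open>1 / \<epsilon>\<close> from the speed of
  \<open>tik\<close> cancels against \<open>\<epsilon>'\<close>, leaving only the logarithmic
  derivative.\<close>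

lemma \<xi>_deriv:
  assumes t: "t > t0"
  obtains D where "(\<xi> has_vector_derivative D) (at t)"
    "norm D \<le> (\<delta>' t / \<delta> t + p / t) * norm (\<xi> t)"
proof -
  have e: "\<epsilon> t > 0" using \<epsilon>_pos t by simp
  obtain D where D: "(tik has_vector_derivative D) (at (\<epsilon> t))" "norm D \<le> norm (\<xi> t) / \<epsilon> t"
    using tik_has_vector_derivative[OF argmin_ne e] by (auto simp: \<xi>_def)
  have "(\<xi> has_vector_derivative \<epsilon>' t *\<^sub>R D) (at t)"
    using vector_diff_chain_at[of \<epsilon> "\<epsilon>' t" t tik D] \<epsilon>_deriv[OF t] D(1)
    by (simp add: \<xi>_def[abs_def] o_def has_real_derivative_iff_has_vector_derivative)
  moreover have "norm (\<epsilon>' t *\<^sub>R D) \<le> (\<delta>' t / \<delta> t + p / t) * norm (\<xi> t)"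
  proof -
    have "norm (\<epsilon>' t *\<^sub>R D) \<le> - \<epsilon>' t * (norm (\<xi> t) / \<epsilon> t)"
      using mult_left_mono[OF D(2), of "- \<epsilon>' t"] \<epsilon>'_nonpos[OF t] by simp
    then show ?thesis using e by (simp add: \<epsilon>'_def)
  qed
  ultimately show ?thesis by (rule that)
qed

text \<open>Stationarity of \<open>\<xi>\<close> removes the linear term from the strong convexity
  inequality.\<close>

lemma \<phi>_ge:
  assumes t: "t \<ge> t0"
  shows "\<epsilon> t / 2 * (norm (x t - \<xi> t))\<^sup>2 \<le> \<phi> t"
  using tikhonov_strong_convexity[of "\<xi> t" "\<epsilon> t" "x t"] \<xi>_grad[OF t]
  by (simp add: \<phi>_def)

lemma \<phi>_nonneg: "t \<ge> t0 \<Longrightarrow> \<phi> t \<ge> 0"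
  using \<phi>_ge[of t] \<epsilon>_pos[of t] by (smt (verit) divide_nonneg_nonneg mult_nonneg_nonneg zero_le_power2)

text \<open>The parallelogram law makes the energy equivalent to
  \<open>\<delta> \<phi> + |y|\<^sup>2 + |w|\<^sup>2\<close>. The upper estimate converts
  dissipation into decay, the others convert decay into rates.\<close>

lemma energy_bounds:
  assumes t: "t \<ge> t0"
  shows "0 \<le> energy t" "\<delta> t * \<phi> t \<le> energy t" "(norm (y t))\<^sup>2 \<le> 4 * energy t" "(norm (w t))\<^sup>2 \<le> 4 * energy t"
    "energy t \<le> 2 * (\<delta> t * \<phi> t + (norm (y t))\<^sup>2 + (norm (w t))\<^sup>2)"
proof -
  have \<delta>\<phi>: "\<delta> t * \<phi> t \<ge> 0" using \<phi>_nonneg[OF t] \<delta>_pos[OF t] by simp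
  have par: "(norm (u - v))\<^sup>2 \<le> 2 * (norm u)\<^sup>2 + 2 * (norm v)\<^sup>2" for u v :: 'a
  proof -
    have "0 \<le> (norm (u + v))\<^sup>2" by simp
    also have "\<dots> = 2 * (norm u)\<^sup>2 + 2 * (norm v)\<^sup>2 - (norm (u - v))\<^sup>2"
      unfolding power2_norm_eq_inner
      by (simp add: inner_diff_left inner_diff_right inner_add_left inner_add_right inner_commute)
    finally show ?thesis by simp
  qed
  have 1: "(norm (y t))\<^sup>2 \<le> 2 * (norm (w t + y t))\<^sup>2 + 2 * (norm (w t))\<^sup>2"
    using par[of "w t + y t" "w t"] by simp
  have 2: "(norm (w t + y t))\<^sup>2 \<le> 2 * (norm (w t))\<^sup>2 + 2 * (norm (y t))\<^sup>2"
    using par[of "w t" "- y t"] by simp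
  have nn: "(norm (w t + y t))\<^sup>2 \<ge> 0" "(norm (w t))\<^sup>2 \<ge> 0" "(norm (y t))\<^sup>2 \<ge> 0" by simp_all
  show "0 \<le> energy t" "\<delta> t * \<phi> t \<le> energy t" "(norm (y t))\<^sup>2 \<le> 4 * energy t" "(norm (w t))\<^sup>2 \<le> 4 * energy t"
    "energy t \<le> 2 * (\<delta> t * \<phi> t + (norm (y t))\<^sup>2 + (norm (w t))\<^sup>2)"
    using \<delta>\<phi> 1 2 nn unfolding energy_def by argo+
qed

lemma energy_deriv:
  assumes t: "t > t0"
  shows "(energy has_real_derivative deriv energy t) (at t)"
    and "deriv energy t \<le> \<delta>' t * \<phi> t - \<delta> t * \<epsilon>' t / 2 * (norm (\<xi> t))\<^sup>2 - b t * (\<delta> t * \<phi> t)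
      - \<delta> t * \<epsilon> t / (2 * b t) * (norm (w t))\<^sup>2
      - b t * (norm (y t))\<^sup>2 + \<beta> * (b t)\<^sup>2 / (2 * \<delta> t) * (norm (y t))\<^sup>2
      + (\<beta> * \<epsilon> t + q / t) * (norm (y t) * norm (w t))
      + b t * (\<beta> * \<epsilon> t) * (norm (y t) * norm (\<xi> t))
      + b t * ((2 * norm (w t) + norm (y t)) * ((\<delta>' t / \<delta> t + p / t) * norm (\<xi> t)))"
proof -
  have t': "t > 0" "t \<ge> t0" "\<delta> t > 0" "\<epsilon> t > 0" "b t > 0"
    using t t0 \<delta>_pos[of t] \<epsilon>_pos[of t] b_pos[of t] by auto
  obtain \<xi>' where \<xi>': "(\<xi> has_vector_derivative \<xi>') (at t)"
    "norm \<xi>' \<le> (\<delta>' t / \<delta> t + p / t) * norm (\<xi> t)" by (rule \<xi>_deriv[OF t])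
  define G where "G = grad (x t) + \<epsilon> t *\<^sub>R x t"
  define x' where "x' = y t - \<beta> *\<^sub>R grad (x t)"
  define w' where "w' = - (q / t) *\<^sub>R w t + b t *\<^sub>R (x' - \<xi>')"
  define y' where "y' = - (2 * b t) *\<^sub>R x' - \<delta> t *\<^sub>R G"
  have xd: "(x has_vector_derivative x') (at t)" using x_deriv[OF t] by (simp add: x'_def)
  have yd: "(y has_vector_derivative y') (at t)"
  proof -
    have "\<alpha> / t powr q = 2 * b t" by (simp add: b_def powr_minus field_simps)
    moreover have "a / t powr p = \<delta> t * \<epsilon> t" using t' by (simp add: \<epsilon>_def)
    ultimately have "- ((\<alpha> / t powr q) *\<^sub>R (y t - \<beta> *\<^sub>R grad (x t)) + \<delta> t *\<^sub>R grad (x t) + (a / t powr p) *\<^sub>R x t) = y'"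
      by (simp add: y'_def G_def x'_def algebra_simps)
    then show ?thesis using y_deriv[OF t] by simp
  qed
  have bd: "(b has_real_derivative - (q / t) * b t) (at t)"
    unfolding b_def[abs_def] using t' by (auto intro!: derivative_eq_intros simp: powr_diff field_simps)
  have wd: "(w has_vector_derivative w') (at t)"
  proof -
    have "((\<lambda>t. b t *\<^sub>R (x t - \<xi> t)) has_vector_derivative
        b t *\<^sub>R (x' - \<xi>') + (- (q / t) * b t) *\<^sub>R (x t - \<xi> t)) (at t)"
      by (intro has_vector_derivative_scaleR bd has_vector_derivative_diff xd \<xi>')
    then show ?thesis by (simp add: w_def[abs_def] w'_def algebra_simps)
  qed
  have gd: "((\<lambda>t. g (f t)) has_real_derivative inner (grad (f t)) f') (at t)"
    if "(f has_vector_derivative f') (at t)" for f f'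
    using has_derivative_compose[OF that[unfolded has_vector_derivative_def] g_deriv]
    by (simp add: has_field_derivative_def mult_commute_abs)
  have nd: "((\<lambda>t. (norm (f t))\<^sup>2) has_real_derivative 2 * inner (f t) f') (at t)"
    if "(f has_vector_derivative f') (at t)" for f and f' :: 'a
  proof -
    have "((\<lambda>t. inner (f t) (f t)) has_derivative (\<lambda>h. inner (f t) (h *\<^sub>R f') + inner (h *\<^sub>R f') (f t))) (at t)"
      by (intro has_derivative_inner that[unfolded has_vector_derivative_def])
    then show ?thesis
      unfolding power2_norm_eq_inner has_field_derivative_def
      by (rule has_derivative_eq_rhs) (auto simp: inner_commute)
  qed
  have \<phi>d: "(\<phi> has_real_derivative inner G x' + \<epsilon>' t / 2 * ((norm (x t))\<^sup>2 - (norm (\<xi> t))\<^sup>2)) (at t)"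
  proof -
    \<comment> \<open>The envelope argument: the derivative of the regularized value along its
      minimizer has no contribution from the motion of \<open>\<xi>\<close>.\<close>
    have stat: "inner (grad (\<xi> t)) \<xi>' + \<epsilon> t * inner (\<xi> t) \<xi>' = 0"
      using arg_cong[OF \<xi>_grad[OF t'(2)], of "\<lambda>u. inner u \<xi>'"] by (simp add: inner_add_left)
    note reg = DERIV_add[OF gd DERIV_mult[OF DERIV_cdivide[OF \<epsilon>_deriv[OF t], of 2] nd]]
    show ?thesis
      unfolding \<phi>_def[abs_def]
      by (rule DERIV_cong[OF DERIV_diff[OF reg[OF xd xd] reg[OF \<xi>'(1) \<xi>'(1)]]])
        (use stat in \<open>simp add: G_def inner_add_left field_simps\<close>)
  qed
  define dE where "dE = \<delta>' t * \<phi> t + \<delta> t * (inner G x' + \<epsilon>' t / 2 * ((norm (x t))\<^sup>2 - (norm (\<xi> t))\<^sup>2))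
      + inner (w t + y t) (w' + y') + inner (w t) w'"
  have dE: "(energy has_real_derivative dE) (at t)"
    unfolding energy_def[abs_def] dE_def
    by (rule DERIV_cong[OF DERIV_add[OF DERIV_add[OF DERIV_mult[OF \<delta>_deriv[OF t] \<phi>d]
            DERIV_cdivide[OF nd[OF has_vector_derivative_add[OF wd yd]]]] DERIV_cdivide[OF nd[OF wd]]]])
      (simp add: algebra_simps)
  then have deriv_eq: "deriv energy t = dE" by (rule DERIV_imp_deriv)
  show "(energy has_real_derivative deriv energy t) (at t)" using dE deriv_eq by simp
  have "dE \<le> \<delta>' t * \<phi> t - \<delta> t * \<epsilon>' t / 2 * (norm (\<xi> t))\<^sup>2 - b t * (\<delta> t * \<phi> t)
      - \<delta> t * \<epsilon> t / (2 * b t) * (norm (w t))\<^sup>2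
      - b t * (norm (y t))\<^sup>2 + \<beta> * (b t)\<^sup>2 / (2 * \<delta> t) * (norm (y t))\<^sup>2
      + (\<beta> * \<epsilon> t + q / t) * (norm (y t) * norm (w t))
      + b t * (\<beta> * \<epsilon> t) * (norm (y t) * norm (\<xi> t))
      + b t * ((2 * norm (w t) + norm (y t)) * norm \<xi>')"
    unfolding dE_def
  proof (rule lyapunov_dissipation)
    show "\<epsilon>' t \<le> - \<beta> * (\<epsilon> t)\<^sup>2" by (rule \<epsilon>'_le[OF t])
    show "\<phi> t + \<epsilon> t / 2 * (norm (x t - \<xi> t))\<^sup>2 \<le> inner G (x t - \<xi> t)"
      using tikhonov_strong_convexity[of "x t" "\<epsilon> t" "\<xi> t"]
      by (simp add: \<phi>_def G_def inner_diff_right norm_minus_commute)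
    show "x' = y t - \<beta> *\<^sub>R G + (\<beta> * \<epsilon> t) *\<^sub>R x t" by (simp add: x'_def G_def algebra_simps)
  qed (use t' params in \<open>auto simp: w_def w'_def y'_def\<close>)
  moreover have "b t * ((2 * norm (w t) + norm (y t)) * norm \<xi>')
      \<le> b t * ((2 * norm (w t) + norm (y t)) * ((\<delta>' t / \<delta> t + p / t) * norm (\<xi> t)))"
    using \<xi>'(2) t' by (intro mult_left_mono) auto
  ultimately show "deriv energy t \<le> \<delta>' t * \<phi> t - \<delta> t * \<epsilon>' t / 2 * (norm (\<xi> t))\<^sup>2 - b t * (\<delta> t * \<phi> t)
      - \<delta> t * \<epsilon> t / (2 * b t) * (norm (w t))\<^sup>2
      - b t * (norm (y t))\<^sup>2 + \<beta> * (b t)\<^sup>2 / (2 * \<delta> t) * (norm (y t))\<^sup>2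
      + (\<beta> * \<epsilon> t + q / t) * (norm (y t) * norm (w t))
      + b t * (\<beta> * \<epsilon> t) * (norm (y t) * norm (\<xi> t))
      + b t * ((2 * norm (w t) + norm (y t)) * ((\<delta>' t / \<delta> t + p / t) * norm (\<xi> t)))"
    unfolding deriv_eq by linarith
qed


text \<open>With \<open>m = max q (p - q)\<close> the slower damping is of order
  \<open>t powr (-m)\<close>: \<open>q\<close> comes from the viscosity, \<open>p - q\<close> from
  the distance term. Each entry is the decay exponent of a source after division by this damping:
  \<open>p + 1\<close> from the drift of the weight, \<open>2 * q + 2 - m\<close> from the motion of
  \<open>\<xi>\<close> and the Hessian term with \<open>\<xi>\<close>, after Young's
  inequality.\<close>

definition rate :: real
  where "rate = min (p + 1 - max q (p - q)) (2 * q + 2 - 2 * max q (p - q))"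

text \<open>Terms of order \<open>E / t\<close> are absorbed because \<open>m < 1\<close>, terms
  linear in the square root of \<open>E\<close> are split by Young's inequality, and the scalar
  decay lemma does the rest.\<close>

lemma energy_decay: "\<exists>M>0. \<forall>\<^sub>F t in at_top. energy t \<le> M * t powr (- rate)"
proof -
  define m where "m = max q (p - q)"
  define s where "s = rate"
  have m: "m < 1" "q \<le> m" "p - q \<le> m" using params pq by (auto simp: m_def)
  have "m \<le> q + 1" using m(1) params by simp
  then have s: "s \<ge> 0" "s \<le> p + 1 - m" "s \<le> 2 * q + 2 - 2 * m"
    using m(1) params by (auto simp: s_def rate_def m_def[symmetric])
  obtain K where K: "K > 0" and Kev: "\<forall>\<^sub>F t in at_top. t * \<delta>' t < K * \<delta> t" using K1 by blast
  obtain z0 where z0: "z0 \<in> argmin g" using argmin_ne by blast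
  define R0 where "R0 = norm z0"
  \<comment> \<open>Thus \<open>\<kappa> * t powr (-m)\<close> stays below \<open>b t / 2\<close>
    and below the coefficient of \<open>(norm (w t))\<^sup>2\<close> in the dissipation.\<close>
  define \<kappa> where "\<kappa> = min (\<alpha> / 4) (a / \<alpha>)"
  \<comment> \<open>Since \<open>Y\<close> and \<open>W\<close> are at most \<open>2 * e\<close>,
    the Hessian term contributes 4 and \<open>2 * W + Y\<close> contributes 6.\<close>
  define Q where "Q = \<alpha> / 2 * ((4 + 6 * (K + p)) * R0)"
  define D1 where "D1 = a * (K + p) / 2 * R0\<^sup>2"
  define C where "C = D1 + 2 * Q\<^sup>2 / \<kappa>"
  have \<kappa>: "\<kappa> > 0" "\<kappa> \<le> \<alpha> / 4" "\<kappa> \<le> a / \<alpha>"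
    using params by (simp_all only: \<kappa>_def min.cobounded1 min.cobounded2) simp
  have D1: "D1 \<ge> 0" using params K by (simp add: D1_def)
  have C: "C \<ge> 0" using D1 \<kappa> by (simp add: C_def)
  define dE where "dE = deriv energy"
  have "((\<lambda>t. (K + 12) * t powr (m - 1)) \<longlongrightarrow> (K + 12) * 0) at_top"
    using m by (intro tendsto_mult tendsto_const tendsto_neg_powr filterlim_ident) auto
  then have small: "\<forall>\<^sub>F t in at_top. (K + 12) * t powr (m - 1) < \<kappa> / 8"
    using \<kappa> by (intro order_tendstoD(2)) auto
  \<comment> \<open>This confines the quadratic error in \<open>y\<close> that is left by the
    Hessian damping to half of the viscous damping.\<close>
  have \<delta>big: "\<forall>\<^sub>F t in at_top. \<delta> t \<ge> \<beta> * \<alpha>"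
    using \<delta>_lim by (simp add: filterlim_at_top)
  have "\<forall>\<^sub>F t in at_top. dE t \<le> - (\<kappa> / 4) * t powr (-m) * energy t + C * t powr (-m - s)"
    using eventually_gt_at_top[of "max 1 t0"] Kev \<epsilon>_le small \<delta>big
  proof eventually_elim
    case (elim t)
    then have t: "t > 1" "t > t0" "t \<ge> t0" "t > 0" and Kt: "t * \<delta>' t < K * \<delta> t" and \<epsilon>t: "\<beta> * \<epsilon> t \<le> 2 / t"
      and sm: "(K + 12) * t powr (m - 1) < \<kappa> / 8" and \<delta>t: "\<delta> t \<ge> \<beta> * \<alpha>" by auto
    note eb = energy_bounds[OF t(3)]
    define e where "e = sqrt (energy t)"
    define Y where "Y = norm (y t)"
    define W where "W = norm (w t)"
    define R where "R = norm (\<xi> t)"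
    define h where "h = \<delta>' t / \<delta> t + p / t"
    define \<tau> where "\<tau> = t powr (-m)"
    have e: "e \<ge> 0" "e\<^sup>2 = energy t" using eb(1) by (auto simp: e_def)
    have YW: "0 \<le> Y" "0 \<le> W" "Y \<le> 2 * e" "W \<le> 2 * e"
    proof -
      show "Y \<le> 2 * e" "W \<le> 2 * e"
        by (rule power2_le_imp_le; use eb e in \<open>simp add: Y_def W_def power_mult_distrib\<close>)+
    qed (auto simp: Y_def W_def)
    have R: "0 \<le> R" "R \<le> R0" using \<xi>_norm_le[OF t(3) z0] by (auto simp: R_def R0_def)
    have R0: "R0 \<ge> 0" by (simp add: R0_def)
    have \<delta>p: "\<delta> t > 0" and \<epsilon>p: "\<epsilon> t > 0" and bp: "b t > 0" and \<phi>n: "\<phi> t \<ge> 0"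
      using \<delta>_pos \<epsilon>_pos b_pos \<phi>_nonneg t by auto
    have \<delta>': "\<delta>' t / \<delta> t \<le> K / t" using Kt \<delta>p t by (simp add: field_simps)
    have h: "h \<le> (K + p) / t" using \<delta>' by (simp add: h_def add_divide_distrib)
    have b_le: "b t \<le> \<alpha>" "b t \<ge> \<alpha> / 2 * \<tau>"
    proof -
      have "t powr (-q) \<le> t powr 0" using t params by (intro powr_mono) auto
      then show "b t \<le> \<alpha>" using t params by (simp add: b_def)
      show "b t \<ge> \<alpha> / 2 * \<tau>"
        unfolding b_def \<tau>_def using t params m by (intro mult_left_mono powr_mono) auto
    qed
    have T1: "\<delta>' t * \<phi> t \<le> K / t * e\<^sup>2"
    proof -
      have "\<delta>' t * \<phi> t = (\<delta>' t / \<delta> t) * (\<delta> t * \<phi> t)" using \<delta>p by simp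
      also have "\<dots> \<le> K / t * (\<delta> t * \<phi> t)" using \<delta>' \<delta>p \<phi>n by (intro mult_right_mono) auto
      also have "\<dots> \<le> K / t * e\<^sup>2" using eb(2) K t e by (intro mult_left_mono) auto
      finally show ?thesis .
    qed
    have T2: "- \<delta> t * \<epsilon>' t / 2 * R\<^sup>2 \<le> D1 * t powr (-p - 1)"
    proof -
      have "- \<delta> t * \<epsilon>' t / 2 * R\<^sup>2 = (a * t powr (-p)) / 2 * (h * R\<^sup>2)"
        using \<delta>_\<epsilon>[OF t(3)] by (simp add: \<epsilon>'_def h_def)
      also have "\<dots> \<le> (a * t powr (-p)) / 2 * ((K + p) / t * R0\<^sup>2)"
      proof (intro mult_left_mono)
        have "h * R\<^sup>2 \<le> (K + p) / t * R\<^sup>2" using h by (intro mult_right_mono) auto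
        also have "\<dots> \<le> (K + p) / t * R0\<^sup>2" using K params t R by (intro mult_left_mono power_mono) auto
        finally show "h * R\<^sup>2 \<le> (K + p) / t * R0\<^sup>2" .
      qed (use params in auto)
      also have "\<dots> = D1 * t powr (-p - 1)"
        using t by (simp add: D1_def powr_diff)
      finally show ?thesis .
    qed
    have T3: "(\<beta> * \<epsilon> t + q / t) * (Y * W) \<le> 12 / t * e\<^sup>2"
    proof -
      have "q / t \<le> 1 / t" using params t by (simp add: divide_right_mono)
      then have "\<beta> * \<epsilon> t + q / t \<le> 3 / t" using \<epsilon>t by (simp add: field_simps)
      moreover have "Y * W \<le> (2 * e) * (2 * e)" using YW e by (intro mult_mono) auto
      ultimately have "(\<beta> * \<epsilon> t + q / t) * (Y * W) \<le> 3 / t * ((2 * e) * (2 * e))"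
        using YW t by (intro mult_mono) auto
      then show ?thesis by (simp add: power2_eq_square)
    qed
    have T4: "b t * (\<beta> * \<epsilon> t) * (Y * R) + b t * ((2 * W + Y) * (h * R)) \<le> Q * t powr (-q - 1) * e"
    proof -
      have "(\<beta> * \<epsilon> t) * (Y * R) \<le> (2 / t) * ((2 * e) * R0)"
        using \<epsilon>t YW R e t by (intro mult_mono) auto
      moreover have "(2 * W + Y) * (h * R) \<le> (6 * e) * ((K + p) / t * R0)"
      proof -
        have "h * R \<le> (K + p) / t * R" using h R by (intro mult_right_mono) auto
        also have "\<dots> \<le> (K + p) / t * R0" using K params t R by (intro mult_left_mono) auto
        finally have hR: "h * R \<le> (K + p) / t * R0" .
        have "(2 * W + Y) * (h * R) \<le> (2 * W + Y) * ((K + p) / t * R0)"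
          using hR YW by (intro mult_left_mono) auto
        also have "\<dots> \<le> (6 * e) * ((K + p) / t * R0)"
          using YW K params t R0 by (intro mult_right_mono) auto
        finally show ?thesis .
      qed
      moreover have "(2 / t) * ((2 * e) * R0) + (6 * e) * ((K + p) / t * R0) = (4 + 6 * (K + p)) * R0 * e / t"
        using t by (simp add: field_simps)
      ultimately have "(\<beta> * \<epsilon> t) * (Y * R) + (2 * W + Y) * (h * R)
          \<le> (4 + 6 * (K + p)) * R0 * e / t" by linarith
      then have "b t * ((\<beta> * \<epsilon> t) * (Y * R) + (2 * W + Y) * (h * R))
          \<le> b t * ((4 + 6 * (K + p)) * R0 * e / t)" using bp by (intro mult_left_mono) auto
      also have "\<dots> = Q * t powr (-q - 1) * e"
        using t by (simp add: b_def Q_def powr_diff)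
      finally show ?thesis by (simp add: distrib_left mult.assoc)
    qed
    \<comment> \<open>Young's inequality with weight \<open>\<kappa> / 4 * \<tau>\<close>, whose
      inverse raises the power of \<open>t\<close> in the source by \<open>m\<close>.\<close>
    have T5: "Q * t powr (-q - 1) * e \<le> \<kappa> / 8 * \<tau> * e\<^sup>2 + 2 * Q\<^sup>2 / \<kappa> * t powr (m - 2 * q - 2)"
    proof -
      have k: "\<kappa> / 4 * \<tau> > 0" using \<kappa> t by (simp add: \<tau>_def)
      have "2 * (e * (Q * t powr (-q - 1))) \<le> \<kappa> / 4 * \<tau> * e\<^sup>2 + (Q * t powr (-q - 1))\<^sup>2 / (\<kappa> / 4 * \<tau>)"
        using weighted_inner_le[OF k, of e "Q * t powr (-q - 1)"] by simp
      moreover have "(Q * t powr (-q - 1))\<^sup>2 / (\<kappa> / 4 * \<tau>) = 4 * Q\<^sup>2 / \<kappa> * t powr (m - 2 * q - 2)"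
      proof -
        have eq: "(t powr (-q - 1))\<^sup>2 / \<tau> = t powr (m - 2 * q - 2)"
          using t by (simp add: \<tau>_def powr_power powr_diff[symmetric] algebra_simps)
        have "(Q * t powr (-q - 1))\<^sup>2 / (\<kappa> / 4 * \<tau>) = 4 * Q\<^sup>2 / \<kappa> * ((t powr (-q - 1))\<^sup>2 / \<tau>)"
          by (simp add: power_mult_distrib)
        then show ?thesis unfolding eq .
      qed
      ultimately show ?thesis by (simp add: mult.commute mult.left_commute)
    qed
    have T6: "(K + 12) / t * e\<^sup>2 \<le> \<kappa> / 8 * \<tau> * e\<^sup>2"
    proof (rule mult_right_mono)
      have "(K + 12) / t = (K + 12) * t powr (m - 1) * \<tau>"
      proof -
        have "t powr (m - 1) * \<tau> = 1 / t"
          unfolding \<tau>_def powr_add[symmetric] using t by (simp add: powr_minus_divide)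
        then show ?thesis by (simp only: mult.assoc) simp
      qed
      also have "\<dots> \<le> \<kappa> / 8 * \<tau>" using sm by (intro mult_right_mono) (auto simp: \<tau>_def)
      finally show "(K + 12) / t \<le> \<kappa> / 8 * \<tau>" .
    qed simp
    have T7: "b t * (\<delta> t * \<phi> t) + \<delta> t * \<epsilon> t / (2 * b t) * W\<^sup>2 + b t * Y\<^sup>2 - \<beta> * (b t)\<^sup>2 / (2 * \<delta> t) * Y\<^sup>2
        \<ge> \<kappa> / 2 * \<tau> * e\<^sup>2"
    proof -
      have \<tau>0: "\<tau> \<ge> 0" by (simp add: \<tau>_def)
      have k1: "\<kappa> * \<tau> \<le> b t / 2"
        using b_le(2) mult_right_mono[OF \<kappa>(2) \<tau>0] by simp
      have b1: "b t * (\<delta> t * \<phi> t) \<ge> \<kappa> * \<tau> * (\<delta> t * \<phi> t)"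
        using k1 bp \<delta>p \<phi>n by (intro mult_right_mono) auto
      have b2: "\<delta> t * \<epsilon> t / (2 * b t) * W\<^sup>2 \<ge> \<kappa> * \<tau> * W\<^sup>2"
      proof (rule mult_right_mono)
        have "\<delta> t * \<epsilon> t / (2 * b t) = a / \<alpha> * t powr (q - p)"
          using params t unfolding \<delta>_\<epsilon>[OF t(3)] by (simp add: b_def powr_minus powr_diff field_simps)
        moreover have "\<kappa> * \<tau> \<le> a / \<alpha> * t powr (q - p)"
          unfolding \<tau>_def using \<kappa> m t params by (intro mult_mono powr_mono) auto
        ultimately show "\<kappa> * \<tau> \<le> \<delta> t * \<epsilon> t / (2 * b t)" by simp
      qed simp
      have b3: "\<beta> * (b t)\<^sup>2 / (2 * \<delta> t) * Y\<^sup>2 \<le> b t / 2 * Y\<^sup>2"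
      proof (rule mult_right_mono)
        have "\<beta> * b t \<le> \<delta> t" using \<delta>t mult_left_mono[OF b_le(1), of \<beta>] params by linarith
        then have "b t * (\<beta> * b t) \<le> b t * \<delta> t" using bp by (intro mult_left_mono) auto
        then show "\<beta> * (b t)\<^sup>2 / (2 * \<delta> t) \<le> b t / 2" using \<delta>p by (simp add: field_simps power2_eq_square)
      qed simp
      have b4: "\<kappa> * \<tau> * Y\<^sup>2 \<le> b t / 2 * Y\<^sup>2" using k1 by (intro mult_right_mono) auto
      have "\<kappa> / 2 * \<tau> * e\<^sup>2 \<le> \<kappa> / 2 * \<tau> * (2 * (\<delta> t * \<phi> t + Y\<^sup>2 + W\<^sup>2))"
        using eb(5) e \<kappa> \<tau>0 by (intro mult_left_mono) (auto simp: Y_def W_def)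
      also have "\<dots> = \<kappa> * \<tau> * (\<delta> t * \<phi> t) + \<kappa> * \<tau> * Y\<^sup>2 + \<kappa> * \<tau> * W\<^sup>2"
        by (simp add: algebra_simps)
      also have "\<dots> \<le> b t * (\<delta> t * \<phi> t) + (b t * Y\<^sup>2 - \<beta> * (b t)\<^sup>2 / (2 * \<delta> t) * Y\<^sup>2) + \<delta> t * \<epsilon> t / (2 * b t) * W\<^sup>2"
      proof -
        have "b t / 2 * Y\<^sup>2 + b t / 2 * Y\<^sup>2 = b t * Y\<^sup>2" by simp
        then show ?thesis using b1 b2 b3 b4 by linarith
      qed
      finally show ?thesis by linarith
    qed
    have T8: "D1 * t powr (-p - 1) + 2 * Q\<^sup>2 / \<kappa> * t powr (m - 2 * q - 2) \<le> C * t powr (-m - s)"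
    proof -
      have "D1 * t powr (-p - 1) \<le> D1 * t powr (-m - s)"
        using D1 s t by (intro mult_left_mono powr_mono) auto
      moreover have "2 * Q\<^sup>2 / \<kappa> * t powr (m - 2 * q - 2) \<le> 2 * Q\<^sup>2 / \<kappa> * t powr (-m - s)"
        using \<kappa> s t by (intro mult_left_mono powr_mono) auto
      ultimately show ?thesis by (simp add: C_def distrib_right)
    qed
    have T13: "K / t * e\<^sup>2 + 12 / t * e\<^sup>2 = (K + 12) / t * e\<^sup>2" by (simp add: add_divide_distrib distrib_right)
    \<comment> \<open>Of the total dissipation, one eighth each goes to \<open>T5\<close> and
      \<open>T6\<close>, and the remaining quarter drives the decay.\<close>
    have split: "\<kappa> / 2 * \<tau> * e\<^sup>2 = \<kappa> / 8 * \<tau> * e\<^sup>2 + \<kappa> / 8 * \<tau> * e\<^sup>2 + \<kappa> / 4 * \<tau> * e\<^sup>2" by simp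
    have "dE t \<le> - (\<kappa> / 4 * \<tau> * e\<^sup>2) + C * t powr (-m - s)"
      using energy_deriv(2)[OF t(2), folded Y_def W_def R_def h_def dE_def] T1 T2 T3 T4 T5 T6 T7 T8 T13 split
      by linarith
    then show ?case by (simp add: \<tau>_def e(2))
  qed
  moreover have "\<forall>\<^sub>F t in at_top. (energy has_real_derivative dE t) (at t)"
    using eventually_gt_at_top[of t0] unfolding dE_def by eventually_elim (rule energy_deriv(1))
  ultimately show ?thesis
    using power_decay_of_differential_inequality[of m "\<kappa> / 4" C s energy dE] m \<kappa> C s unfolding s_def by auto
qed

end

section \<open>Convergence rates\<close>

lemma powr_half_square: "((t :: real) powr (u / 2))\<^sup>2 = t powr u"
  by (simp add: power2_eq_square powr_add[symmetric])

context tikhonov_flow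
begin

lemma \<epsilon>_tendsto: "filterlim \<epsilon> (at_right 0) at_top"
proof -
  have "((\<lambda>t. 2 / \<beta> * inverse t) \<longlongrightarrow> 2 / \<beta> * 0) at_top"
    by (intro tendsto_intros tendsto_inverse_0_at_top filterlim_ident)
  then have lim: "((\<lambda>t. 2 / \<beta> * inverse t) \<longlongrightarrow> 0) at_top" by simp
  have pos: "\<forall>\<^sub>F t in at_top. \<epsilon> t > 0"
    using eventually_ge_at_top[of t0] by eventually_elim (rule \<epsilon>_pos)
  have "(\<epsilon> \<longlongrightarrow> 0) at_top"
  proof (rule tendsto_sandwich[OF _ _ tendsto_const lim])
    show "\<forall>\<^sub>F t in at_top. 0 \<le> \<epsilon> t" using pos by eventually_elim simp
    show "\<forall>\<^sub>F t in at_top. \<epsilon> t \<le> 2 / \<beta> * inverse t"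
      using \<epsilon>_le eventually_gt_at_top[of 0]
      by eventually_elim (use params in \<open>simp add: field_simps\<close>)
  qed
  then show ?thesis
    using pos by (simp add: filterlim_at eventually_mono)
qed

lemma \<xi>_tendsto:
  assumes "(tik \<longlongrightarrow> z) (at_right 0)"
  shows "(\<xi> \<longlongrightarrow> z) at_top"
  using filterlim_compose[OF assms \<epsilon>_tendsto] by (simp add: \<xi>_def[abs_def])

lemma velocity_bigo: "(\<lambda>t. norm (y t)) \<in> O(\<lambda>t. 1 / t powr (rate / 2))"
proof -
  obtain M where M: "M > 0" "\<forall>\<^sub>F t in at_top. energy t \<le> M * t powr (- rate)"
    using energy_decay by blast
  show ?thesis
  proof (rule bigoI[of _ "2 * sqrt M"])
    show "\<forall>\<^sub>F t in at_top. norm (norm (y t)) \<le> 2 * sqrt M * norm (1 / t powr (rate / 2))"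
      using M(2) eventually_gt_at_top[of t0]
    proof eventually_elim
      case (elim t)
      have "norm (y t) \<le> 2 * sqrt M * t powr (- rate / 2)"
      proof (rule power2_le_imp_le)
        have "(norm (y t))\<^sup>2 \<le> 4 * (M * t powr (- rate))"
          using energy_bounds(3)[of t] elim by simp
        also have "\<dots> = (2 * sqrt M * t powr (- rate / 2))\<^sup>2"
          unfolding power_mult_distrib powr_half_square using M(1) by simp
        finally show "(norm (y t))\<^sup>2 \<le> (2 * sqrt M * t powr (- rate / 2))\<^sup>2" .
      qed (use M in simp)
      then show ?case by (simp add: powr_minus field_simps)
    qed
  qed
qed

text \<open>The distance is read off from \<open>w\<close>; dividing by \<open>b\<close> costs a
  factor \<open>t powr q\<close>.\<close>

lemma distance_bigo: "(\<lambda>t. norm (x t - \<xi> t)) \<in> O(\<lambda>t. 1 / t powr (rate / 2 - q))"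
proof -
  obtain M where M: "M > 0" "\<forall>\<^sub>F t in at_top. energy t \<le> M * t powr (- rate)"
    using energy_decay by blast
  show ?thesis
  proof (rule bigoI[of _ "4 / \<alpha> * sqrt M"])
    show "\<forall>\<^sub>F t in at_top. norm (norm (x t - \<xi> t)) \<le> 4 / \<alpha> * sqrt M * norm (1 / t powr (rate / 2 - q))"
      using M(2) eventually_gt_at_top[of t0]
    proof eventually_elim
      case (elim t)
      have t: "t > 0" using elim t0 by simp
      have "norm (w t) \<le> 2 * sqrt M * t powr (- rate / 2)"
      proof (rule power2_le_imp_le)
        have "(norm (w t))\<^sup>2 \<le> 4 * (M * t powr (- rate))"
          using energy_bounds(4)[of t] elim by simp
        also have "\<dots> = (2 * sqrt M * t powr (- rate / 2))\<^sup>2"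
          unfolding power_mult_distrib powr_half_square using M(1) by simp
        finally show "(norm (w t))\<^sup>2 \<le> (2 * sqrt M * t powr (- rate / 2))\<^sup>2" .
      qed (use M in simp)
      moreover have "norm (w t) = \<alpha> / 2 * t powr (-q) * norm (x t - \<xi> t)"
        using params by (simp add: w_def b_def abs_mult)
      ultimately have "norm (x t - \<xi> t) \<le> 4 / \<alpha> * sqrt M * (t powr (- rate / 2) / t powr (-q))"
        using params t by (simp add: field_simps)
      also have "t powr (- rate / 2) / t powr (-q) = 1 / t powr (rate / 2 - q)"
        using t by (simp add: powr_diff[symmetric] powr_minus_divide[symmetric])
      finally show ?case by simp
    qed
  qed
qed

text \<open>The distance is read off from the value gap by strong convexity, at the cost of
  \<open>t powr (p / 2)\<close>; this is the better bound when \<open>p < 2 * q\<close>.\<close>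

lemma distance_bigo': "(\<lambda>t. norm (x t - \<xi> t)) \<in> O(\<lambda>t. 1 / t powr ((rate - p) / 2))"
proof -
  obtain M where M: "M > 0" "\<forall>\<^sub>F t in at_top. energy t \<le> M * t powr (- rate)"
    using energy_decay by blast
  show ?thesis
  proof (rule bigoI[of _ "sqrt (2 * M / a)"])
    show "\<forall>\<^sub>F t in at_top. norm (norm (x t - \<xi> t)) \<le> sqrt (2 * M / a) * norm (1 / t powr ((rate - p) / 2))"
      using M(2) eventually_gt_at_top[of t0]
    proof eventually_elim
      case (elim t)
      have t: "t > 0" "t \<ge> t0" using elim t0 by auto
      have "norm (x t - \<xi> t) \<le> sqrt (2 * M / a) * t powr (- (rate - p) / 2)"
      proof (rule power2_le_imp_le)
        have "a * t powr (-p) / 2 * (norm (x t - \<xi> t))\<^sup>2 = \<delta> t * (\<epsilon> t / 2 * (norm (x t - \<xi> t))\<^sup>2)"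
          using \<delta>_\<epsilon>[OF t(2)] by simp
        also have "\<dots> \<le> \<delta> t * \<phi> t"
          using \<phi>_ge[OF t(2)] \<delta>_pos[OF t(2)] by (intro mult_left_mono) auto
        also have "\<dots> \<le> M * t powr (- rate)" using energy_bounds(2)[OF t(2)] elim by simp
        finally have "(norm (x t - \<xi> t))\<^sup>2 \<le> 2 * M / a * (t powr (- rate) / t powr (-p))"
          using params t by (simp add: field_simps)
        also have "t powr (- rate) / t powr (-p) = (t powr (- (rate - p) / 2))\<^sup>2"
          by (simp add: powr_diff[symmetric] powr_half_square)
        finally show "(norm (x t - \<xi> t))\<^sup>2 \<le> (sqrt (2 * M / a) * t powr (- (rate - p) / 2))\<^sup>2"
          using M params by (simp add: power_mult_distrib)
      qed (use M params in simp)
      also have "t powr (- (rate - p) / 2) = 1 / t powr ((rate - p) / 2)"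
        by (simp add: powr_minus_divide[symmetric] minus_divide_left)
      finally show ?case by simp
    qed
  qed
qed

text \<open>The gap to \<open>z\<close> exceeds \<open>\<phi>\<close> by at most
  \<open>\<epsilon> / 2 * (norm z)\<^sup>2\<close>, which after multiplication by
  \<open>\<delta>\<close> is of order \<open>t powr (-p)\<close>; hence the two upper limits on
  \<open>r\<close>.\<close>

lemma value_bigo:
  assumes z: "z \<in> argmin g" and r: "r \<le> rate" "r \<le> p"
  shows "(\<lambda>t. g (x t) - g z) \<in> O(\<lambda>t. 1 / (\<delta> t * t powr r))"
proof -
  obtain M where M: "M > 0" "\<forall>\<^sub>F t in at_top. energy t \<le> M * t powr (- rate)"
    using energy_decay by blast
  define N where "N = a / 2 * (norm z)\<^sup>2"
  have N: "N \<ge> 0" using params by (simp add: N_def)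
  show ?thesis
  proof (rule bigoI[of _ "M + N"])
    show "\<forall>\<^sub>F t in at_top. norm (g (x t) - g z) \<le> (M + N) * norm (1 / (\<delta> t * t powr r))"
      using M(2) eventually_gt_at_top[of "max 1 t0"]
    proof eventually_elim
      case (elim t)
      have t: "t > 1" "t \<ge> t0" using elim by auto
      have \<delta>: "\<delta> t > 0" using \<delta>_pos t by simp
      have nn: "g (x t) - g z \<ge> 0" using z by (simp add: argmin_iff)
      have "g (\<xi> t) + \<epsilon> t / 2 * (norm (\<xi> t))\<^sup>2 \<le> g z + \<epsilon> t / 2 * (norm z)\<^sup>2"
        using tikhonov_strong_convexity[of "\<xi> t" "\<epsilon> t" z] \<xi>_grad[OF t(2)] \<epsilon>_pos[OF t(2)]
        by (smt (verit) inner_zero_left mult_nonneg_nonneg half_gt_zero zero_le_power2)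
      moreover have "\<epsilon> t / 2 * (norm (x t))\<^sup>2 \<ge> 0" using \<epsilon>_pos[OF t(2)] by simp
      ultimately have "g (x t) - g z \<le> \<phi> t + \<epsilon> t / 2 * (norm z)\<^sup>2" by (simp add: \<phi>_def)
      then have "\<delta> t * (g (x t) - g z) \<le> \<delta> t * (\<phi> t + \<epsilon> t / 2 * (norm z)\<^sup>2)"
        using \<delta> by (intro mult_left_mono) auto
      also have "\<dots> = \<delta> t * \<phi> t + N * t powr (-p)"
        using \<delta>_\<epsilon>[OF t(2)] by (simp add: N_def distrib_left)
      also have "\<dots> \<le> M * t powr (-r) + N * t powr (-r)"
      proof (rule add_mono)
        have "\<delta> t * \<phi> t \<le> M * t powr (- rate)" using energy_bounds(2)[OF t(2)] elim by simp
        also have "\<dots> \<le> M * t powr (-r)" using M t r by (intro mult_left_mono powr_mono) auto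
        finally show "\<delta> t * \<phi> t \<le> M * t powr (-r)" .
        show "N * t powr (-p) \<le> N * t powr (-r)" using N t r by (intro mult_left_mono powr_mono) auto
      qed
      finally have "\<delta> t * (g (x t) - g z) \<le> (M + N) * t powr (-r)" by (simp add: distrib_right)
      then have "g (x t) - g z \<le> (M + N) * (1 / (\<delta> t * t powr r))"
        using \<delta> t by (simp add: powr_minus_divide field_simps)
      then show ?case using nn \<delta> t by simp
    qed
  qed
qed

text \<open>The two entries of \<open>rate\<close> cross at \<open>2 * p = 3 * q + 1\<close>. As
  \<open>q < 1\<close>, this lies above \<open>p = 2 * q\<close>, so beyond the crossing the maximum
  is \<open>p - q\<close>.\<close>

lemma rate_less: "p < (3 * q + 1) / 2 \<Longrightarrow> rate = p + 1 - max q (p - q)"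
  using params pq by (auto simp: rate_def max_def min_def)

lemma rate_ge: "(3 * q + 1) / 2 \<le> p \<Longrightarrow> rate = 2 * (2 * q - p + 1)"
  using params pq by (auto simp: rate_def max_def min_def)

text \<open>The value gap serves for \<open>p \<le> 2 * q\<close> and \<open>w\<close> beyond; both
  give the same exponent.\<close>

lemma distance_bigo_less:
  assumes "p < (3 * q + 1) / 2"
  shows "(\<lambda>t. norm (x t - \<xi> t)) \<in> O(\<lambda>t. 1 / t powr ((1 - q) / 2))"
proof (cases "p - q \<le> q")
  case True
  then have eq: "(rate - p) / 2 = (1 - q) / 2" using rate_less[OF assms] by simp
  show ?thesis using distance_bigo' unfolding eq .
next
  case False
  then have eq: "rate / 2 - q = (1 - q) / 2" using rate_less[OF assms] by (simp add: field_simps)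
  show ?thesis using distance_bigo unfolding eq .
qed

lemma distance_bigo_ge:
  assumes "(3 * q + 1) / 2 \<le> p"
  shows "(\<lambda>t. norm (x t - \<xi> t)) \<in> O(\<lambda>t. 1 / t powr (q - p + 1))"
proof -
  have eq: "rate / 2 - q = q - p + 1" using rate_ge[OF assms] by simp
  show ?thesis using distance_bigo unfolding eq .
qed

lemma trajectory_tendsto:
  assumes "(tik \<longlongrightarrow> z) (at_right 0)"
  shows "(x \<longlongrightarrow> z) at_top"
proof -
  \<comment> \<open>The distance exponent is positive in both regimes, by \<open>q < 1\<close> and
    \<open>p < q + 1\<close> respectively.\<close>
  obtain r where r: "r > 0" and O: "(\<lambda>t. norm (x t - \<xi> t)) \<in> O(\<lambda>t. 1 / t powr r)"
    using distance_bigo_less distance_bigo_ge params pq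
    by (metis add.commute diff_add_eq diff_gt_0_iff_gt half_gt_zero linorder_not_less add_diff_eq)
  have "((\<lambda>t. t powr (-r)) \<longlongrightarrow> 0) at_top"
    using r by (intro tendsto_neg_powr filterlim_ident) auto
  then have "((\<lambda>t. 1 / t powr r) \<longlongrightarrow> 0) at_top" by (simp add: powr_minus_divide)
  then have lim: "((\<lambda>t. c * norm (1 / t powr r)) \<longlongrightarrow> 0) at_top" for c
    by (intro tendsto_mult_right_zero tendsto_norm_zero)
  obtain c where "\<forall>\<^sub>F t in at_top. norm (norm (x t - \<xi> t)) \<le> c * norm (1 / t powr r)"
    by (rule landau_o.bigE[OF O])
  then have "((\<lambda>t. norm (x t - \<xi> t)) \<longlongrightarrow> 0) at_top"
    by (rule Lim_null_comparison[OF _ lim])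
  then have "((\<lambda>t. (x t - \<xi> t) + \<xi> t) \<longlongrightarrow> 0 + z) at_top"
    by (intro tendsto_add \<xi>_tendsto[OF assms]) (simp add: tendsto_norm_zero_iff)
  then show ?thesis by simp
qed

lemma tikhonov_min_eq: "tikhonov_min g a p \<delta> t = \<xi> t"
  by (simp add: tikhonov_min_def \<xi>_def tik_def \<epsilon>_def mult.assoc mult.commute[of 2] divide_divide_eq_left)

end

section \<open>Strong convergence and rates for the second order system\<close>

theorem theorem3p4:
  fixes g :: "'a::{real_inner, complete_space} \<Rightarrow> real"
    and grad :: "'a \<Rightarrow> 'a" and hess :: "'a \<Rightarrow> 'a \<Rightarrow> 'a"
    and t0 \<alpha> \<beta> a p q :: real
    and \<delta> \<delta>' :: "real \<Rightarrow> real"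
    and u0 v0 :: 'a
    and x v :: "real \<Rightarrow> 'a"
  assumes convex: "convex_on UNIV g"
    and grad: "\<And>y. GDERIV g y :> grad y"
    and hess: "\<And>y. (grad has_derivative hess y) (at y)"
    and argmin: "argmin g \<noteq> {}"
    and t0: "t0 > 0"
    and params: "\<alpha> > 0" "\<beta> > 0" "a > 0" "p > 0" "0 < q" "q < 1"
    and \<delta>_pos: "\<And>t. t \<ge> t0 \<Longrightarrow> \<delta> t > 0"
    and \<delta>_deriv: "\<And>t. t \<ge> t0 \<Longrightarrow> (\<delta> has_real_derivative \<delta>' t) (at t within {t0..})"
    and \<delta>_mono: "mono_on {t0..} \<delta>"
    and \<delta>_lim: "filterlim \<delta> at_top at_top"
    and pq: "q < p" "p < q + 1"
    and growth: "\<And>t. t \<ge> t0 \<Longrightarrow> t powr p * \<delta>' t + p * t powr (p - 1) * \<delta> t - a * \<beta> \<ge> 0"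
    and K1: "\<exists>K1>0. \<forall>\<^sub>F t in at_top. t * \<delta>' t < K1 * \<delta> t"
    and sol: "strong_global_solution t0 \<alpha> \<beta> a p q \<delta> grad hess u0 v0 x v"
  shows "(x \<longlongrightarrow> metric_proj (argmin g) 0) at_top \<and>
    (p < (3 * q + 1) / 2 \<longrightarrow>
      (\<lambda>t. norm (v t + \<beta> *\<^sub>R grad (x t))) \<in> O(\<lambda>t. 1 / t powr ((p + 1 - max q (p - q)) / 2)) \<and>
      (\<lambda>t. norm (x t - tikhonov_min g a p \<delta> t)) \<in> O(\<lambda>t. 1 / t powr ((1 - q) / 2)) \<and>
      (\<lambda>t. g (x t) - g (metric_proj (argmin g) 0)) \<in> O(\<lambda>t. 1 / (\<delta> t * t powr p))) \<and>
    ((3 * q + 1) / 2 \<le> p \<longrightarrow>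
      (\<lambda>t. norm (v t + \<beta> *\<^sub>R grad (x t))) \<in> O(\<lambda>t. 1 / t powr (2 * q - p + 1)) \<and>
      (\<lambda>t. norm (x t - tikhonov_min g a p \<delta> t)) \<in> O(\<lambda>t. 1 / t powr (q - p + 1)) \<and>
      (p \<le> (4 * q + 2) / 3 \<longrightarrow>
        (\<lambda>t. g (x t) - g (metric_proj (argmin g) 0)) \<in> O(\<lambda>t. 1 / (\<delta> t * t powr p))) \<and>
      ((4 * q + 2) / 3 < p \<longrightarrow>
        (\<lambda>t. g (x t) - g (metric_proj (argmin g) 0))
          \<in> O(\<lambda>t. 1 / (\<delta> t * t powr (4 * q - 2 * p + 2)))))"
proof -
  define y where "y = (\<lambda>t. v t + \<beta> *\<^sub>R grad (x t))"
  have \<delta>_cont: "continuous_on {t0..} \<delta>"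
    using \<delta>_deriv by (intro DERIV_continuous_on) auto
  have y_eq: "v t + \<beta> *\<^sub>R grad (x t) = y t" for t by (simp add: y_def)
  have v_eq: "v t = y t - \<beta> *\<^sub>R grad (x t)" for t by (simp add: y_def)
  note derivs = strong_global_solution_derivs[OF hess t0 \<delta>_cont sol]
  interpret smooth_convex g grad hess
    by unfold_locales (fact convex grad hess)+
  interpret tikhonov_flow g grad hess t0 \<alpha> \<beta> a p q \<delta> \<delta>' x y
  proof unfold_locales
    show "(\<delta> has_real_derivative \<delta>' t) (at t)" if "t > t0" for t
    proof -
      have "at t within {t0..} = at t"
        using that by (intro at_within_interior) (simp add: interior_real_atLeast)
      then show ?thesis using \<delta>_deriv[of t] that by simp
    qed
    show "(x has_vector_derivative y t - \<beta> *\<^sub>R grad (x t)) (at t)" if "t > t0" for t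
      using derivs(1)[OF that] by (simp add: v_eq)
    show "(y has_vector_derivative - ((\<alpha> / t powr q) *\<^sub>R (y t - \<beta> *\<^sub>R grad (x t))
        + \<delta> t *\<^sub>R grad (x t) + (a / t powr p) *\<^sub>R x t)) (at t)" if "t > t0" for t
      using derivs(2)[OF that, folded y_def] unfolding v_eq .
  qed (fact argmin t0 params \<delta>_pos \<delta>_lim pq growth K1)+
  obtain z where z: "z \<in> argmin g" "\<And>w. w \<in> argmin g \<Longrightarrow> norm z \<le> norm w" "(tik \<longlongrightarrow> z) (at_right 0)"
    using tik_tendsto_min_norm[OF argmin] by blast
  have proj: "metric_proj (argmin g) 0 = z"
    by (rule metric_proj_argmin[OF argmin z(1,2)])
  show ?thesis
    unfolding proj tikhonov_min_eq y_eq
  proof (intro conjI impI)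
    show "(x \<longlongrightarrow> z) at_top" by (rule trajectory_tendsto[OF z(3)])
  next
    assume less: "p < (3 * q + 1) / 2"
    show "(\<lambda>t. norm (y t)) \<in> O(\<lambda>t. 1 / t powr ((p + 1 - max q (p - q)) / 2))"
      using velocity_bigo unfolding rate_less[OF less] .
    show "(\<lambda>t. norm (x t - \<xi> t)) \<in> O(\<lambda>t. 1 / t powr ((1 - q) / 2))"
      by (rule distance_bigo_less[OF less])
    \<comment> \<open>Here \<open>p \<le> rate\<close> because the maximum of \<open>q\<close> and
      \<open>p - q\<close> is below 1.\<close>
    show "(\<lambda>t. g (x t) - g z) \<in> O(\<lambda>t. 1 / (\<delta> t * t powr p))"
      using params pq by (intro value_bigo[OF z(1)]) (auto simp: rate_less[OF less])
  next
    assume ge: "(3 * q + 1) / 2 \<le> p"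
    have half: "rate / 2 = 2 * q - p + 1" using rate_ge[OF ge] by simp
    show "(\<lambda>t. norm (y t)) \<in> O(\<lambda>t. 1 / t powr (2 * q - p + 1))"
      using velocity_bigo unfolding half .
    show "(\<lambda>t. norm (x t - \<xi> t)) \<in> O(\<lambda>t. 1 / t powr (q - p + 1))"
      by (rule distance_bigo_ge[OF ge])
    \<comment> \<open>The threshold is where \<open>rate = 4 * q - 2 * p + 2\<close> equals
      \<open>p\<close>; above it the exponent is \<open>rate\<close> itself.\<close>
    show "(\<lambda>t. g (x t) - g z) \<in> O(\<lambda>t. 1 / (\<delta> t * t powr p))" if "p \<le> (4 * q + 2) / 3"
      using that by (intro value_bigo[OF z(1)]) (auto simp: rate_ge[OF ge])
    show "(\<lambda>t. g (x t) - g z) \<in> O(\<lambda>t. 1 / (\<delta> t * t powr (4 * q - 2 * p + 2)))" if "(4 * q + 2) / 3 < p"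
      using that by (intro value_bigo[OF z(1)]) (auto simp: rate_ge[OF ge])
  qed
qed

end
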